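(* Let $1/2<p<1$, $\gamma=\frac{1-p}{p}$, and let $b,w\ge 1$ be integers. Let $(B_n,W_n)_{n\ge 0}$ be the two-colour urn process with parameter $p$ started from $(B_0,W_0)=(b,w)$ and stopped when one of the colours disappears, and let $f_{b,w}(n)=\frac{B_n}{B_n+W_n}$. Then $\lim_{n\to\infty}f_{b,w}(n)$ exists almost surely, and its distribution is the mixture $$r_{b,w}\,\delta_0+r^{\ast}_{b,w}\,\mathrm{Beta}(G_b,H_w)+r_{w,b}\,\delta_1,$$ where $$r_{b,w}=\gamma^b\Bigl(1-\frac{b}{b+w}\gamma^{w}\Bigr),\qquad r_{w,b}=\gamma^w\Bigl(1-\frac{w}{b+w}\gamma^{b}\Bigr),\qquad r^{\ast}_{b,w}=(1-\gamma^b)(1-\gamma^w),$$ and $G_b,H_w$ are independent discrete random variables with $$\mathbb{P}[G_b=k]=\frac{1}{1-\gamma^{b}}\binom{b}{k}(1-\gamma)^k\gamma^{b-k},\quad k=1,\dots,b,$$ $$\mathbb{P}[H_w=k]=\frac{1}{1-\gamma^{w}}\binom{w}{k}(1-\gamma)^k\gamma^{w-k},\quad k=1,\dots,w.$$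
   Context: Two-colour urn process with parameter $p$: $B_n$ and $W_n$ are the numbers of black and white balls at time $n$. If $B_n\neq 0$ and $W_n\neq 0$, then conditionally on the past $(B_{n+1},W_{n+1})$ equals $(B_n+1,W_n)$ with probability $p\frac{B_n}{B_n+W_n}$, $(B_n,W_n+1)$ with probability $p\frac{W_n}{B_n+W_n}$, $(B_n-1,W_n)$ with probability $(1-p)\frac{B_n}{B_n+W_n}$, and $(B_n,W_n-1)$ with probability $(1-p)\frac{W_n}{B_n+W_n}$. If $B_n=0$ or $W_n=0$, the process is stopped: $(B_m,W_m)=(B_n,W_n)$ for all $m\ge n$ (so $0$ and $1$ are absorbing for $f_{b,w}$). $\delta_x$ is the unit point mass at $x$. $\mathrm{Beta}(G_b,H_w)$ denotes the mixed Beta distribution: the law of a random variable which, conditionally on $G_b=k$ and $H_w=l$, has the $\mathrm{Beta}(k,l)$ distribution. *)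

theory Defs
  imports "HOL-Probability.Probability"
begin

definition urn_trans :: "real \<Rightarrow> nat \<times> nat \<Rightarrow> nat \<times> nat \<Rightarrow> real" where
  "urn_trans p s t =
     (case s of (b, w) \<Rightarrow>
        if b = 0 \<or> w = 0 then (if t = (b, w) then 1 else 0)
        else if t = (b + 1, w) then p * (real b / real (b + w))
        else if t = (b, w + 1) then p * (real w / real (b + w))
        else if t = (b - 1, w) then (1 - p) * (real b / real (b + w))
        else if t = (b, w - 1) then (1 - p) * (real w / real (b + w))
        else 0)"

text \<open>
  The past up to time \<open>n\<close> takes countably many values, so conditioning on it means conditioning
  on each history \<open>h 0, \<dots>, h n\<close> of positive probability.
\<close>

locale two_colour_urn = prob_space M
  for M :: "'a measure" and p :: real and b w :: nat and B W :: "nat \<Rightarrow> 'a \<Rightarrow> nat" +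
  assumes random_variable_B: "\<And>n. random_variable (count_space UNIV) (B n)"
    and random_variable_W: "\<And>n. random_variable (count_space UNIV) (W n)"
    and start: "AE \<omega> in M. B 0 \<omega> = b \<and> W 0 \<omega> = w"
    and transition:
      "\<And>n h t. \<P>(\<omega> in M. \<forall>i\<le>n. (B i \<omega>, W i \<omega>) = h i) > 0 \<Longrightarrow>
         \<P>(\<omega> in M. (B (Suc n) \<omega>, W (Suc n) \<omega>) = t \<bar> \<forall>i\<le>n. (B i \<omega>, W i \<omega>) = h i)
           = urn_trans p (h n) t"

definition black_fraction :: "(nat \<Rightarrow> 'a \<Rightarrow> nat) \<Rightarrow> (nat \<Rightarrow> 'a \<Rightarrow> nat) \<Rightarrow> nat \<Rightarrow> 'a \<Rightarrow> real" where
  "black_fraction B W n \<omega> = real (B n \<omega>) / real (B n \<omega> + W n \<omega>)"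

definition beta_density :: "real \<Rightarrow> real \<Rightarrow> real \<Rightarrow> real" where
  "beta_density \<alpha> \<beta> x =
     (if 0 < x \<and> x < 1 then x powr (\<alpha> - 1) * (1 - x) powr (\<beta> - 1) / Beta \<alpha> \<beta> else 0)"

definition beta_distribution :: "real \<Rightarrow> real \<Rightarrow> real measure" where
  "beta_distribution \<alpha> \<beta> = density lborel (\<lambda>x. ennreal (beta_density \<alpha> \<beta> x))"

text \<open>The common form of the laws of \<open>G\<^sub>b\<close> (with \<open>m = b\<close>) and \<open>H\<^sub>w\<close> (with \<open>m = w\<close>).\<close>

definition survivors_pmf :: "real \<Rightarrow> nat \<Rightarrow> nat pmf" where
  "survivors_pmf \<gamma> m = embed_pmf (\<lambda>k.
     if k \<in> {1..m} then 1 / (1 - \<gamma> ^ m) * real (m choose k) * (1 - \<gamma>) ^ k * \<gamma> ^ (m - k) else 0)"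

text \<open>
  \<open>G\<close> and \<open>H\<close> are the laws of two independent random variables. A parameter \<open>0\<close> makes
  \<open>beta_distribution\<close> the null measure; it has probability zero under \<open>survivors_pmf\<close>.
\<close>

definition mixed_beta :: "nat pmf \<Rightarrow> nat pmf \<Rightarrow> real measure" where
  "mixed_beta G H =
     measure_pmf (pair_pmf G H) \<bind> (\<lambda>(k, l). beta_distribution (real k) (real l))"

definition extinction_weight :: "real \<Rightarrow> nat \<Rightarrow> nat \<Rightarrow> real" where
  "extinction_weight \<gamma> b w = \<gamma> ^ b * (1 - real b / real (b + w) * \<gamma> ^ w)"

lemma pmf_survivors:
  assumes "0 < \<gamma>" "\<gamma> < 1" "1 \<le> m"
  shows "pmf (survivors_pmf \<gamma> m) k =
     (if k \<in> {1..m} then 1 / (1 - \<gamma> ^ m) * real (m choose k) * (1 - \<gamma>) ^ k * \<gamma> ^ (m - k) else 0)"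
proof -
  define f where "f = (\<lambda>k. if k \<in> {1..m}
    then 1 / (1 - \<gamma> ^ m) * real (m choose k) * (1 - \<gamma>) ^ k * \<gamma> ^ (m - k) else 0)"
  have lt: "\<gamma> ^ m < 1"
    using assms by (simp add: power_less_one_iff)
  have nonneg: "0 \<le> f j" for j
    using assms lt by (auto simp: f_def)
  have "(\<Sum>j\<le>m. real (m choose j) * (1 - \<gamma>) ^ j * \<gamma> ^ (m - j)) = 1"
    using binomial_ring[of "1 - \<gamma>" \<gamma> m] by simp
  moreover have "{..m} = insert 0 {1..m}" by auto
  ultimately have s: "(\<Sum>j=1..m. real (m choose j) * (1 - \<gamma>) ^ j * \<gamma> ^ (m - j)) = 1 - \<gamma> ^ m"
    by simp
  have "(\<Sum>j=1..m. f j) =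
      (1 / (1 - \<gamma> ^ m)) * (\<Sum>j=1..m. real (m choose j) * (1 - \<gamma>) ^ j * \<gamma> ^ (m - j))"
    unfolding sum_distrib_left f_def by (intro sum.cong) (auto simp: mult.assoc)
  then have total: "(\<Sum>j=1..m. f j) = 1"
    unfolding s using lt by simp
  have "(\<integral>\<^sup>+ j. ennreal (f j) \<partial>count_space UNIV) = (\<Sum>j=1..m. ennreal (f j))"
    by (rule nn_integral_count_space'[of "{1..m}"]) (auto simp: f_def)
  also have "\<dots> = 1"
    using nonneg total by (simp add: sum_ennreal)
  finally have "pmf (embed_pmf f) k = f k"
    using nonneg by (intro pmf_embed_pmf) auto
  then show ?thesis
    by (simp add: survivors_pmf_def f_def)
qed

lemma sets_beta_distribution [simp, measurable_cong]: "sets (beta_distribution \<alpha> \<beta>) = sets borel"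
  by (simp add: beta_distribution_def)

lemma borel_measurable_beta_density [measurable]: "beta_density \<alpha> \<beta> \<in> borel_measurable borel"
  unfolding beta_density_def by measurable

lemma prob_space_beta_distribution:
  assumes "0 < \<alpha>" "0 < \<beta>"
  shows "prob_space (beta_distribution \<alpha> \<beta>)"
proof -
  have pos: "0 < Beta \<alpha> \<beta>"
    using assms by (simp add: Beta_def Gamma_real_pos)
  have "((\<lambda>x. x powr (\<alpha> - 1) * (1 - x) powr (\<beta> - 1)) has_integral Beta \<alpha> \<beta>) {0..1}"
    by (rule has_integral_Beta_real) (use assms in auto)
  then have "((\<lambda>x. x powr (\<alpha> - 1) * (1 - x) powr (\<beta> - 1) * (1 / Beta \<alpha> \<beta>)) has_integral
      Beta \<alpha> \<beta> * (1 / Beta \<alpha> \<beta>)) {0..1}"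
    by (rule has_integral_mult_left)
  then have "((\<lambda>x. x powr (\<alpha> - 1) * (1 - x) powr (\<beta> - 1) / Beta \<alpha> \<beta>) has_integral 1) {0..1}"
    using pos by simp
  then have "(beta_density \<alpha> \<beta> has_integral 1) {0..1}"
    by (rule has_integral_spike_finite[of "{0, 1}", rotated 2]) (auto simp: beta_density_def)
  then have "(beta_density \<alpha> \<beta> has_integral 1) UNIV"
    by (rule has_integral_on_superset) (auto simp: beta_density_def)
  then have "(\<integral>\<^sup>+ x. ennreal (beta_density \<alpha> \<beta> x) \<partial>lborel) = ennreal 1"
  proof (intro nn_integral_has_integral_lborel)
    show "0 \<le> beta_density \<alpha> \<beta> x" for x
      using pos by (auto simp: beta_density_def)
  qed simp_all
  then show ?thesis
    by (intro prob_spaceI) (simp add: beta_distribution_def emeasure_density)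
qed

lemma beta_distribution_subprob:
  "beta_distribution (real k) (real l) \<in> space (subprob_algebra borel)"
proof (cases "k = 0 \<or> l = 0")
  case True
  then have "beta_density (real k) (real l) x = 0" for x
    by (auto simp: beta_density_def Beta_def)
  then have "emeasure (beta_distribution (real k) (real l)) UNIV = 0"
    by (simp add: beta_distribution_def emeasure_density)
  then show ?thesis
    by (auto simp: space_subprob_algebra beta_distribution_def intro!: subprob_spaceI)
next
  case False
  then have "prob_space (beta_distribution (real k) (real l))"
    by (intro prob_space_beta_distribution) auto
  then show ?thesis
    by (auto simp: space_subprob_algebra intro: prob_space_imp_subprob_space)
qed

lemma emeasure_mixed_beta:
  assumes "A \<in> sets borel"
  shows "emeasure (mixed_beta G H) A =
    (\<integral>\<^sup>+ kl. emeasure (beta_distribution (real (fst kl)) (real (snd kl))) A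
        \<partial>measure_pmf (pair_pmf G H))"
proof -
  have "(\<lambda>(k, l). beta_distribution (real k) (real l))
      \<in> measurable (measure_pmf (pair_pmf G H)) (subprob_algebra borel)"
    using beta_distribution_subprob by (auto simp: measurable_def)
  then show ?thesis
    unfolding mixed_beta_def using assms
    by (subst emeasure_bind[where N = borel]) (auto simp: case_prod_beta)
qed

end

theory Submission
  imports Defs
begin

text \<open>
  The fraction of black balls is a bounded martingale, so it converges almost surely.

  To find the law of the limit, let each ball independently be the root of an infinite line of
  descent with probability \<open>1 - \<gamma>\<close>; given \<open>b\<close> black and \<open>w\<close> white balls, the numbers of survivors
  \<open>k\<close> and \<open>l\<close> are then independent and binomial. Averaging over \<open>k\<close> and \<open>l\<close> turns the generator of
  the urn into that of a Polya urn started from \<open>(k, l)\<close>, whose limit is \<open>Beta(k, l)\<close> distributed.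
  If nobody survives, the urn is the one with parameters \<open>p\<close> and \<open>1 - p\<close> interchanged, for which the
  fraction is still a martingale, so the last colour is black with probability \<open>b / (b + w)\<close>.
  Hence the integral of a test function \<open>\<phi>\<close> against the mixture started from \<open>(b, w)\<close> is harmonic.
  The mixture concentrates at \<open>b / (b + w)\<close> as \<open>b + w\<close> grows, and an urn that is not absorbed grows,
  so this harmonic function, evaluated along the process, approaches \<open>\<phi>\<close> of the limit. Taking
  \<open>\<phi>\<close> to be \<open>cos (t x)\<close> and \<open>sin (t x)\<close> determines the law.
\<close>

subsection \<open>Transitions and finite paths of the urn\<close>

text \<open>The colour and the direction of the change are drawn independently, so expectations
  split into Bernoulli averages, and replacing \<open>p\<close> by \<open>1 - p\<close> exchanges
  adding with removing.\<close>

definition urn_step :: "real \<Rightarrow> nat \<times> nat \<Rightarrow> (nat \<times> nat) pmf" where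
  "urn_step p s = (case s of (b, w) \<Rightarrow>
     if b = 0 \<or> w = 0 then return_pmf (b, w)
     else do {
       black \<leftarrow> bernoulli_pmf (real b / real (b + w));
       up \<leftarrow> bernoulli_pmf p;
       return_pmf
         (if black then (if up then b + 1 else b - 1, w) else (b, if up then w + 1 else w - 1))})"

definition fraction :: "nat \<times> nat \<Rightarrow> real" where
  "fraction s = real (fst s) / real (fst s + snd s)"

lemma pmf_urn_step:
  assumes "0 \<le> p" "p \<le> 1"
  shows "pmf (urn_step p s) t = urn_trans p s t"
proof (cases s)
  case (Pair b w)
  have le: "real b / (real b + real w) \<le> 1"
    by (simp add: divide_le_eq_1) linarith
  have w: "1 - real b / (real b + real w) = real w / (real b + real w)" if "0 < b"
    using that by (simp add: field_simps)
  show ?thesis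
    using assms le w unfolding Pair urn_step_def urn_trans_def
    by (auto simp: pmf_bind mult_ac)
qed

lemma finite_set_pmf_urn_step [simp]: "finite (set_pmf (urn_step p s))"
  by (auto simp: urn_step_def split: prod.split)

lemma expectation_bind_bernoulli:
  fixes \<phi> :: "'a \<Rightarrow> real"
  assumes "0 \<le> r" "r \<le> 1" "\<And>c. finite (set_pmf (f c))"
  shows "measure_pmf.expectation (bernoulli_pmf r \<bind> f) \<phi> =
    r * measure_pmf.expectation (f True) \<phi> + (1 - r) * measure_pmf.expectation (f False) \<phi>"
  using assms by (subst pmf_expectation_bind[of UNIV]) (auto simp: UNIV_bool)

lemma expectation_urn_step:
  fixes \<phi> :: "nat \<times> nat \<Rightarrow> real"
  assumes "0 \<le> p" "p \<le> 1" "0 < b" "0 < w"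
  shows "measure_pmf.expectation (urn_step p (b, w)) \<phi> =
    real b / real (b + w) * (p * \<phi> (b + 1, w) + (1 - p) * \<phi> (b - 1, w)) +
    real w / real (b + w) * (p * \<phi> (b, w + 1) + (1 - p) * \<phi> (b, w - 1))"
proof -
  have le: "real b / (real b + real w) \<le> 1"
    by (simp add: divide_le_eq_1) linarith
  have w: "1 - real b / (real b + real w) = real w / (real b + real w)"
    using assms by (simp add: field_simps)
  show ?thesis
    using assms le w unfolding urn_step_def
    by (simp add: expectation_bind_bernoulli)
qed

lemma expectation_urn_step_absorbed:
  fixes \<phi> :: "nat \<times> nat \<Rightarrow> real"
  assumes "b = 0 \<or> w = 0"
  shows "measure_pmf.expectation (urn_step p (b, w)) \<phi> = \<phi> (b, w)"
  using assms by (auto simp: urn_step_def)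

lemma fraction_martingale:
  assumes "0 \<le> p" "p \<le> 1"
  shows "measure_pmf.expectation (urn_step p s) fraction = fraction s"
proof (cases s)
  case (Pair b w)
  show ?thesis
  proof (cases "b = 0 \<or> w = 0")
    case True
    then show ?thesis by (simp add: Pair expectation_urn_step_absorbed)
  next
    case False
    define x y where "x = real b" and "y = real w"
    have xy: "1 \<le> x" "1 \<le> y" using False by (auto simp: x_def y_def)
    \<comment> \<open>Adding a ball of the drawn colour preserves the mean fraction, and by the next
      identity so does removing one; hence so does any mixture of the two. The bounds on
      \<open>x\<close> and \<open>y\<close> keep \<open>x + y - 1\<close> positive.\<close>
    have 1: "x / (x + y) * ((x + 1) / (x + y + 1)) + y / (x + y) * (x / (x + y + 1)) = x / (x + y)"
      using xy by (simp add: divide_simps) (simp add: algebra_simps)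
    have 2: "x / (x + y) * ((x - 1) / (x + y - 1)) + y / (x + y) * (x / (x + y - 1)) = x / (x + y)"
      using xy by (simp add: divide_simps) (simp add: algebra_simps)
    have "measure_pmf.expectation (urn_step p s) fraction =
      x / (x + y) * (p * ((x + 1) / (x + y + 1)) + (1 - p) * ((x - 1) / (x + y - 1))) +
      y / (x + y) * (p * (x / (x + y + 1)) + (1 - p) * (x / (x + y - 1)))"
      using False assms
      by (simp add: Pair fraction_def expectation_urn_step x_def y_def of_nat_diff add_ac add_diff_eq)
    also have "\<dots> = p * (x / (x + y) * ((x + 1) / (x + y + 1)) + y / (x + y) * (x / (x + y + 1)))
        + (1 - p) * (x / (x + y) * ((x - 1) / (x + y - 1)) + y / (x + y) * (x / (x + y - 1)))"
      by (simp only: ring_distribs mult_ac add_ac)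
    also have "\<dots> = x / (x + y)"
      unfolding 1 2 by (subst distrib_right[symmetric]) simp
    finally show ?thesis by (simp add: Pair fraction_def x_def y_def)
  qed
qed

lemma fraction_submartingale:
  assumes "0 \<le> p" "p \<le> 1"
  shows "(fraction s - c)\<^sup>2 \<le> measure_pmf.expectation (urn_step p s) (\<lambda>t. (fraction t - c)\<^sup>2)"
proof -
  note int = integrable_measure_pmf_finite[OF finite_set_pmf_urn_step[of p s]]
  let ?E = "measure_pmf.expectation (urn_step p s)"
  \<comment> \<open>Jensen's inequality by hand: the right-hand side is the tangent of
    \<open>(x - c)\<^sup>2\<close> at \<open>fraction s\<close>, evaluated at the mean, and the
    tangent lies below the parabola.\<close>
  have "(fraction s - c)\<^sup>2 = 2 * (fraction s - c) * (?E fraction - c) - (fraction s - c)\<^sup>2"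
    by (simp add: fraction_martingale[OF assms] power2_eq_square algebra_simps)
  also have "\<dots> = ?E (\<lambda>t. 2 * (fraction s - c) * (fraction t - c) - (fraction s - c)\<^sup>2)"
    by (simp add: int)
  also have "\<dots> \<le> ?E (\<lambda>t. (fraction t - c)\<^sup>2)"
  proof (intro integral_mono int)
    fix t
    show "2 * (fraction s - c) * (fraction t - c) - (fraction s - c)\<^sup>2 \<le> (fraction t - c)\<^sup>2"
      using zero_le_power2[of "(fraction t - c) - (fraction s - c)"]
      by (simp add: power2_eq_square algebra_simps)
  qed
  finally show ?thesis .
qed

text \<open>Whole paths are kept, latest state first, because the transition law conditions on the
  full history and the maximal inequality looks back at earlier states.\<close>

primrec urn_path :: "real \<Rightarrow> nat \<times> nat \<Rightarrow> nat \<Rightarrow> (nat \<times> nat) list pmf" where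
  "urn_path p s 0 = return_pmf [s]"
| "urn_path p s (Suc n) =
     bind_pmf (urn_path p s n) (\<lambda>h. map_pmf (\<lambda>t. t # h) (urn_step p (hd h)))"

lemma finite_set_pmf_urn_path [simp]: "finite (set_pmf (urn_path p s n))"
  by (induction n) auto

lemma expectation_urn_path_Suc:
  fixes F :: "(nat \<times> nat) list \<Rightarrow> real"
  shows "measure_pmf.expectation (urn_path p s (Suc n)) F =
    measure_pmf.expectation (urn_path p s n)
      (\<lambda>h. measure_pmf.expectation (urn_step p (hd h)) (\<lambda>t. F (t # h)))"
  by (simp add: pmf_expectation_bind[of "set_pmf (urn_path p s n)"]
      integral_measure_pmf[of "set_pmf (urn_path p s n)"])

lemma pmf_urn_path_Suc:
  "pmf (urn_path p s (Suc n)) (t # h) = pmf (urn_path p s n) h * pmf (urn_step p (hd h)) t"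
proof -
  have "pmf (map_pmf (\<lambda>t. t # g) (urn_step p (hd g))) (t # h) =
      indicator {h} g * pmf (urn_step p (hd h)) t" for g
  proof (cases "g = h")
    case True
    then show ?thesis using pmf_map_inj'[of "\<lambda>t. t # h"] by (simp add: inj_def)
  next
    case False
    then show ?thesis by (auto simp: pmf_eq_0_set_pmf)
  qed
  then have "pmf (urn_path p s (Suc n)) (t # h) = measure_pmf.expectation (urn_path p s n)
      (\<lambda>g. indicator {h} g * pmf (urn_step p (hd h)) t)"
    by (simp add: pmf_bind)
  then show ?thesis
    by (simp add: measure_pmf_single)
qed

section \<open>Law of the observed histories\<close>

context two_colour_urn
begin

definition state :: "nat \<Rightarrow> 'a \<Rightarrow> nat \<times> nat" where
  "state n \<omega> = (B n \<omega>, W n \<omega>)"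

text \<open>The most recent state comes first.\<close>

primrec history :: "nat \<Rightarrow> 'a \<Rightarrow> (nat \<times> nat) list" where
  "history 0 \<omega> = [state 0 \<omega>]"
| "history (Suc n) \<omega> = state (Suc n) \<omega> # history n \<omega>"

lemma length_history [simp]: "length (history n \<omega>) = Suc n"
  by (induction n) auto

lemma nth_history: "m \<le> n \<Longrightarrow> history n \<omega> ! (n - m) = state m \<omega>"
proof (induction n)
  case (Suc n)
  then show ?case
    by (cases "m = Suc n") (auto simp: Suc_diff_le)
qed simp

lemma hd_history [simp]: "hd (history n \<omega>) = state n \<omega>"
  by (cases n) auto

lemma history_eq_iff:
  assumes "length h = Suc n"
  shows "history n \<omega> = h \<longleftrightarrow> (\<forall>i\<le>n. (B i \<omega>, W i \<omega>) = h ! (n - i))"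
proof -
  have "history n \<omega> = h \<longleftrightarrow> (\<forall>j\<le>n. history n \<omega> ! j = h ! j)"
    using assms by (simp add: list_eq_iff_nth_eq less_Suc_eq_le)
  also have "\<dots> \<longleftrightarrow> (\<forall>i\<le>n. history n \<omega> ! (n - i) = h ! (n - i))"
    by (metis diff_diff_cancel diff_le_self)
  finally show ?thesis
    by (simp add: nth_history state_def)
qed

lemma measurable_state [measurable]: "state n \<in> measurable M (count_space UNIV)"
proof -
  note [measurable] = random_variable_B random_variable_W
  have "state n -` {s} \<inter> space M = {\<omega> \<in> space M. B n \<omega> = fst s \<and> W n \<omega> = snd s}" for s
    by (auto simp: state_def)
  moreover have "{\<omega> \<in> space M. B n \<omega> = fst s \<and> W n \<omega> = snd s} \<in> sets M" for s
    by measurable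
  ultimately show ?thesis
    by (simp add: measurable_count_space_eq2_countable)
qed

lemma measurable_history [measurable]: "history n \<in> measurable M (count_space UNIV)"
proof (induction n)
  case 0
  have "history 0 = (\<lambda>\<omega>. [state 0 \<omega>])" by auto
  then show ?case by simp
next
  case (Suc n)
  note [measurable] = Suc
  have "history (Suc n) -` {h} \<inter> space M =
      (if h = [] then {} else {\<omega> \<in> space M. state (Suc n) \<omega> = hd h \<and> history n \<omega> = tl h})" for h
    by (cases h) auto
  moreover have "{\<omega> \<in> space M. state (Suc n) \<omega> = hd h \<and> history n \<omega> = tl h} \<in> sets M" for h
    by measurable
  ultimately show ?case
    by (simp add: measurable_count_space_eq2_countable)
qed

text \<open>The conditional law multiplies in one step at a time. It says nothing about histories of
  probability zero, but there both sides vanish, the right one by the induction hypothesis.\<close>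

lemma prob_history:
  assumes p: "0 \<le> p" "p \<le> 1"
  shows "\<P>(\<omega> in M. history n \<omega> = h) = pmf (urn_path p (b, w) n) h"
proof (induction n arbitrary: h)
  case 0
  have ae: "AE \<omega> in M. history 0 \<omega> = [(b, w)]"
    using start by (simp add: state_def)
  show ?case
  proof (cases "h = [(b, w)]")
    case True
    then have "\<P>(\<omega> in M. history 0 \<omega> = h) = 1"
      using ae by (subst prob_Collect_eq_1) auto
    then show ?thesis using True by simp
  next
    case False
    then have "AE \<omega> in M. \<not> history 0 \<omega> = h" using ae by auto
    then have "\<P>(\<omega> in M. history 0 \<omega> = h) = 0"
      by (subst prob_Collect_eq_0) auto
    then show ?thesis using False by (simp add: indicator_def)
  qed
next
  case (Suc n)
  show ?case
  proof (cases h)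
    case Nil
    then show ?thesis
      by (auto simp: pmf_eq_0_set_pmf)
  next
    case (Cons t g)
    have ev: "{\<omega> \<in> space M. history (Suc n) \<omega> = h} =
        {\<omega> \<in> space M. state (Suc n) \<omega> = t \<and> history n \<omega> = g}"
      by (auto simp: Cons)
    show ?thesis
    proof (cases "\<P>(\<omega> in M. history n \<omega> = g) > 0")
      case True
      \<comment> \<open>A list of positive probability is attained, so it has the length of a
        history and \<open>transition\<close> applies to it read backwards.\<close>
      then have "length g = Suc n"
        using length_history by (cases "\<exists>\<omega>. history n \<omega> = g") fastforce+
      note eq = history_eq_iff[OF this]
      have hd: "hd g = g ! (n - n)"
        using \<open>length g = Suc n\<close> by (cases g) auto
      have "\<P>(\<omega> in M. (B (Suc n) \<omega>, W (Suc n) \<omega>) = t \<bar> history n \<omega> = g) = urn_trans p (hd g) t"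
        using transition[of n "\<lambda>i. g ! (n - i)" t] True unfolding hd by (simp only: eq)
      then show ?thesis
        using True Suc[of g]
        by (simp add: cond_prob_def ev Cons pmf_urn_path_Suc pmf_urn_step[OF p] state_def field_simps
            del: urn_path.simps)
    next
      case False
      then have 0: "\<P>(\<omega> in M. history n \<omega> = g) = 0"
        by (simp add: zero_less_measure_iff)
      have "\<P>(\<omega> in M. history (Suc n) \<omega> = h) \<le> \<P>(\<omega> in M. history n \<omega> = g)"
        unfolding ev by (intro finite_measure_mono) auto
      then show ?thesis
        using 0 Suc[of g] by (simp add: Cons pmf_urn_path_Suc measure_le_0_iff del: urn_path.simps)
    qed
  qed
qed

lemma distr_history:
  assumes p: "0 \<le> p" "p \<le> 1"
  shows "distr M (count_space UNIV) (history n) = measure_pmf (urn_path p (b, w) n)"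
proof (rule measure_eqI_countable[of _ UNIV])
  fix h
  have "history n -` {h} \<inter> space M = {\<omega> \<in> space M. history n \<omega> = h}" by auto
  then show "emeasure (distr M (count_space UNIV) (history n)) {h} =
      emeasure (measure_pmf (urn_path p (b, w) n)) {h}"
    by (simp add: emeasure_distr emeasure_eq_measure prob_history[OF p] emeasure_pmf_single)
qed auto

lemma integrable_history:
  fixes F :: "(nat \<times> nat) list \<Rightarrow> real"
  assumes p: "0 \<le> p" "p \<le> 1"
  shows "integrable M (\<lambda>\<omega>. F (history n \<omega>))"
proof -
  have "integrable (distr M (count_space UNIV) (history n)) F"
    unfolding distr_history[OF p] by (rule integrable_measure_pmf_finite) simp
  then show ?thesis
    by (subst (asm) integrable_distr_eq) auto
qed

lemma expectation_history:
  fixes F :: "(nat \<times> nat) list \<Rightarrow> real"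
  assumes p: "0 \<le> p" "p \<le> 1"
  shows "expectation (\<lambda>\<omega>. F (history n \<omega>)) = measure_pmf.expectation (urn_path p (b, w) n) F"
  unfolding distr_history[OF p, symmetric] by (subst integral_distr) auto

text \<open>The Markov property, for integrands that may also depend on the past.\<close>

lemma expectation_history_Suc:
  fixes F :: "nat \<times> nat \<Rightarrow> (nat \<times> nat) list \<Rightarrow> real"
  assumes p: "0 \<le> p" "p \<le> 1"
  shows "expectation (\<lambda>\<omega>. F (state (Suc n) \<omega>) (history n \<omega>)) =
    expectation (\<lambda>\<omega>. measure_pmf.expectation (urn_step p (state n \<omega>)) (\<lambda>t. F t (history n \<omega>)))"
  using expectation_history[OF p, of "\<lambda>h. F (hd h) (tl h)" "Suc n"]
    expectation_history[OF p, of "\<lambda>h. measure_pmf.expectation (urn_step p (hd h)) (\<lambda>t. F t h)" n]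
  by (simp add: expectation_urn_path_Suc del: urn_path.simps)

lemma integrable_state:
  fixes F :: "nat \<times> nat \<Rightarrow> real"
  assumes p: "0 \<le> p" "p \<le> 1"
  shows "integrable M (\<lambda>\<omega>. F (state n \<omega>))"
  using integrable_history[OF p, of "\<lambda>h. F (hd h)" n] by simp

lemma expectation_state_Suc:
  fixes F :: "nat \<times> nat \<Rightarrow> real"
  assumes p: "0 \<le> p" "p \<le> 1"
  shows "expectation (\<lambda>\<omega>. F (state (Suc n) \<omega>)) =
    expectation (\<lambda>\<omega>. measure_pmf.expectation (urn_step p (state n \<omega>)) F)"
  using expectation_history_Suc[OF p, of "\<lambda>t _. F t" n] by simp

lemma expectation_state_0:
  fixes F :: "nat \<times> nat \<Rightarrow> real"
  assumes p: "0 \<le> p" "p \<le> 1"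
  shows "expectation (\<lambda>\<omega>. F (state 0 \<omega>)) = F (b, w)"
  using expectation_history[OF p, of "\<lambda>h. F (hd h)" 0] by simp

end

subsection \<open>Almost sure convergence of the fraction\<close>

text \<open>For a martingale bounded in square mean, \<open>a\<close> is the sequence of second
  moments. Its convergence to \<open>l\<close> bounds the probability of an oscillation of size
  \<open>\<epsilon>\<close> after time \<open>m\<close> by
  \<open>(l - a m) / \<epsilon>\<^sup>2\<close>, which tends to \<open>0\<close>; so almost every
  path is Cauchy.\<close>

lemma (in prob_space) AE_convergent_if_maximal_inequality:
  fixes f :: "nat \<Rightarrow> 'a \<Rightarrow> real" and a :: "nat \<Rightarrow> real"
  assumes meas [measurable]: "\<And>n. f n \<in> borel_measurable M"
    and maximal: "\<And>m n \<epsilon>. m \<le> n \<Longrightarrow> 0 < \<epsilon> \<Longrightarrow>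
      \<P>(\<omega> in M. \<exists>k\<in>{m..n}. \<epsilon> \<le> \<bar>f k \<omega> - f m \<omega>\<bar>) \<le> (a n - a m) / \<epsilon>\<^sup>2"
    and "convergent a"
  shows "AE \<omega> in M. convergent (\<lambda>n. f n \<omega>)"
proof -
  obtain l where l: "a \<longlonglongrightarrow> l"
    using \<open>convergent a\<close> by (auto simp: convergent_def)
  have osc: "AE \<omega> in M. \<exists>m. \<forall>k\<ge>m. \<bar>f k \<omega> - f m \<omega>\<bar> < \<epsilon>" if "0 < \<epsilon>" for \<epsilon>
  proof -
    \<comment> \<open>The hypothesis controls the finite windows \<open>F m n\<close>, which
      increase to \<open>E m\<close> as \<open>n\<close> grows.\<close>
    define E where "E m = {\<omega> \<in> space M. \<exists>k\<in>{m..}. \<epsilon> \<le> \<bar>f k \<omega> - f m \<omega>\<bar>}" for m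
    define F where "F m n = {\<omega> \<in> space M. \<exists>k\<in>{m..n}. \<epsilon> \<le> \<bar>f k \<omega> - f m \<omega>\<bar>}" for m n
    have EF: "E m \<in> sets M" "F m n \<in> sets M" for m n
      unfolding E_def F_def by measurable
    have le: "measure M (E m) \<le> (l - a m) / \<epsilon>\<^sup>2" for m
    proof (rule LIMSEQ_le)
      have "(\<Union>n. F m n) = E m"
        by (auto simp: E_def F_def) (meson atLeastAtMost_iff order_refl)
      moreover have "incseq (F m)"
        by (intro incseq_SucI) (auto simp: F_def intro: le_SucI)
      moreover have "range (F m) \<subseteq> events"
        using EF by auto
      ultimately show "(\<lambda>n. measure M (F m n)) \<longlonglongrightarrow> measure M (E m)"
        using finite_Lim_measure_incseq[of "F m"] by simp
      show "(\<lambda>n. (a n - a m) / \<epsilon>\<^sup>2) \<longlonglongrightarrow> (l - a m) / \<epsilon>\<^sup>2"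
        using \<open>0 < \<epsilon>\<close> by (intro tendsto_intros l) auto
      show "\<exists>N. \<forall>n\<ge>N. measure M (F m n) \<le> (a n - a m) / \<epsilon>\<^sup>2"
        using maximal[of m _ \<epsilon>] \<open>0 < \<epsilon>\<close> unfolding F_def by blast
    qed
    have "measure M (\<Inter>m. E m) \<le> 0"
    proof (rule LIMSEQ_le_const)
      have "(\<lambda>m. (l - a m) / \<epsilon>\<^sup>2) \<longlonglongrightarrow> (l - l) / \<epsilon>\<^sup>2"
        using \<open>0 < \<epsilon>\<close> by (intro tendsto_intros l) auto
      then show "(\<lambda>m. (l - a m) / \<epsilon>\<^sup>2) \<longlonglongrightarrow> 0" by simp
      have "measure M (\<Inter>m. E m) \<le> (l - a m) / \<epsilon>\<^sup>2" for m
        by (rule order.trans[OF finite_measure_mono le]) (use EF in auto)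
      then show "\<exists>N. \<forall>m\<ge>N. measure M (\<Inter>m. E m) \<le> (l - a m) / \<epsilon>\<^sup>2" by blast
    qed
    then have "(\<Inter>m. E m) \<in> null_sets M"
      using EF by (auto simp: null_sets_def emeasure_eq_measure measure_le_0_iff)
    then show ?thesis
      by (rule AE_I') (auto simp: E_def not_less)
  qed
  \<comment> \<open>Countably many thresholds suffice, so the quantifier can move inside the almost
    sure statement.\<close>
  have "AE \<omega> in M. \<forall>j. \<exists>m. \<forall>k\<ge>m. \<bar>f k \<omega> - f m \<omega>\<bar> < 1 / real (Suc j)"
    unfolding AE_all_countable by (intro allI osc) simp
  then show ?thesis
  proof eventually_elim
    case (elim \<omega>)
    have "Cauchy (\<lambda>n. f n \<omega>)"
    proof (rule CauchyI)
      fix e :: real assume "0 < e"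
      then obtain j where j: "1 / real (Suc j) < e / 2"
        using reals_Archimedean[of "e / 2"] by (auto simp: inverse_eq_divide)
      obtain m where m: "\<And>k. k \<ge> m \<Longrightarrow> \<bar>f k \<omega> - f m \<omega>\<bar> < 1 / real (Suc j)"
        using elim by blast
      show "\<exists>N. \<forall>i\<ge>N. \<forall>k\<ge>N. norm (f i \<omega> - f k \<omega>) < e"
      proof (intro exI allI impI)
        fix i k assume "m \<le> i" "m \<le> k"
        from this[THEN m] j show "norm (f i \<omega> - f k \<omega>) < e"
          unfolding real_norm_def by linarith
      qed
    qed
    then show ?case by (simp add: Cauchy_convergent_iff)
  qed
qed

lemma fraction_bounds: "0 \<le> fraction s" "fraction s \<le> 1"
proof -
  show "0 \<le> fraction s"
    by (simp add: fraction_def)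
  show "fraction s \<le> 1"
    unfolding fraction_def by (intro divide_le_eq_1[THEN iffD2]) linarith
qed

section \<open>Second moments of the fraction\<close>

context two_colour_urn
begin

lemma black_fraction_eq: "black_fraction B W n \<omega> = fraction (state n \<omega>)"
  by (simp add: black_fraction_def fraction_def state_def)

lemma expectation_fraction_Suc_mult:
  fixes c :: "(nat \<times> nat) list \<Rightarrow> real"
  assumes p: "0 \<le> p" "p \<le> 1"
  shows "expectation (\<lambda>\<omega>. fraction (state (Suc n) \<omega>) * c (history n \<omega>)) =
    expectation (\<lambda>\<omega>. fraction (state n \<omega>) * c (history n \<omega>))"
  using expectation_history_Suc[OF p, of "\<lambda>t h. fraction t * c h" n]
  by (simp add: fraction_martingale[OF p])

lemma expectation_fraction_mult:
  assumes p: "0 \<le> p" "p \<le> 1" and "m \<le> n"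
  shows "expectation (\<lambda>\<omega>. fraction (state n \<omega>) * fraction (state m \<omega>)) =
    expectation (\<lambda>\<omega>. (fraction (state m \<omega>))\<^sup>2)"
  using \<open>m \<le> n\<close>
proof (induction n rule: dec_induct)
  case base
  show ?case by (simp add: power2_eq_square)
next
  case (step n)
  then show ?case
    using expectation_fraction_Suc_mult[OF p, of n "\<lambda>h. fraction (h ! (n - m))"]
    by (simp add: nth_history)
qed

text \<open>Pythagoras: the increment of a martingale after time \<open>m\<close> is orthogonal to
  its value at time \<open>m\<close>.\<close>

lemma expectation_fraction_diff_sq:
  assumes p: "0 \<le> p" "p \<le> 1" and "m \<le> n"
  shows "expectation (\<lambda>\<omega>. (fraction (state n \<omega>) - fraction (state m \<omega>))\<^sup>2) =
    expectation (\<lambda>\<omega>. (fraction (state n \<omega>))\<^sup>2) - expectation (\<lambda>\<omega>. (fraction (state m \<omega>))\<^sup>2)"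
proof -
  have int: "integrable M (\<lambda>\<omega>. fraction (state n \<omega>) * fraction (state m \<omega>))"
    using integrable_history[OF p, of "\<lambda>h. fraction (hd h) * fraction (h ! (n - m))" n] \<open>m \<le> n\<close>
    by (simp add: nth_history)
  have "expectation (\<lambda>\<omega>. (fraction (state n \<omega>) - fraction (state m \<omega>))\<^sup>2) =
      expectation (\<lambda>\<omega>. (fraction (state n \<omega>))\<^sup>2 - 2 * (fraction (state n \<omega>) * fraction (state m \<omega>))
        + (fraction (state m \<omega>))\<^sup>2)"
    by (simp add: power2_diff algebra_simps)
  also have "\<dots> = expectation (\<lambda>\<omega>. (fraction (state n \<omega>))\<^sup>2)
      - 2 * expectation (\<lambda>\<omega>. fraction (state n \<omega>) * fraction (state m \<omega>))
      + expectation (\<lambda>\<omega>. (fraction (state m \<omega>))\<^sup>2)"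
    using integrable_state[OF p, of "\<lambda>s. (fraction s)\<^sup>2"] int by simp
  finally show ?thesis
    using expectation_fraction_mult[OF assms] by simp
qed

text \<open>Kolmogorov's inequality. By induction on \<open>n\<close>, the squared deviation
  integrated over the event that the threshold was reached by time \<open>n\<close> is at least
  \<open>\<epsilon>\<^sup>2\<close> times the probability of that event.\<close>

lemma maximal_inequality:
  assumes p: "0 \<le> p" "p \<le> 1" and "m \<le> n" "0 < \<epsilon>"
  shows "\<P>(\<omega> in M. \<exists>k\<in>{m..n}. \<epsilon> \<le> \<bar>fraction (state k \<omega>) - fraction (state m \<omega>)\<bar>) \<le>
    (expectation (\<lambda>\<omega>. (fraction (state n \<omega>))\<^sup>2) - expectation (\<lambda>\<omega>. (fraction (state m \<omega>))\<^sup>2)) / \<epsilon>\<^sup>2"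
proof -
  \<comment> \<open>\<open>G\<close> reads the indicator \<open>g\<close> off the history list, as
    the Markov property for histories requires.\<close>
  define G :: "nat \<Rightarrow> (nat \<times> nat) list \<Rightarrow> real" where
    "G n h = of_bool (\<exists>k\<in>{m..n}. \<epsilon> \<le> \<bar>fraction (h ! (n - k)) - fraction (h ! (n - m))\<bar>)" for n h
  define g :: "nat \<Rightarrow> 'a \<Rightarrow> real" where
    "g n \<omega> = of_bool (\<exists>k\<in>{m..n}. \<epsilon> \<le> \<bar>fraction (state k \<omega>) - fraction (state m \<omega>)\<bar>)" for n \<omega>
  define y where "y n \<omega> = (fraction (state n \<omega>) - fraction (state m \<omega>))\<^sup>2" for n \<omega>
  have g: "g n \<omega> = G n (history n \<omega>)" if "m \<le> n" for n \<omega>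
    using that by (simp add: g_def G_def nth_history)
  have y: "y n \<omega> = (fraction (hd (history n \<omega>)) - fraction (history n \<omega> ! (n - m)))\<^sup>2"
    if "m \<le> n" for n \<omega>
    using that by (simp add: y_def nth_history)
  have int_g: "integrable M (g n)" if "m \<le> n" for n
    using integrable_history[OF p, of "G n" n] by (simp add: g[OF that, symmetric])
  have int_y: "integrable M (y n)" if "m \<le> n" for n
    unfolding y[OF that] using integrable_history[OF p] .
  have int_gy: "integrable M (\<lambda>\<omega>. g i \<omega> * y j \<omega>)" if "m \<le> i" "m \<le> j" for i j
    by (rule Bochner_Integration.integrable_bound[OF int_y[OF that(2)]])
       (use int_g[OF that(1)] int_y[OF that(2)] in \<open>auto simp: g_def\<close>)
  \<comment> \<open>The indicator and the centre of the square are fixed by the past, so the squared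
    deviation cannot decrease in conditional mean on the event.\<close>
  have submart: "expectation (\<lambda>\<omega>. g n \<omega> * y n \<omega>) \<le> expectation (\<lambda>\<omega>. g n \<omega> * y (Suc n) \<omega>)"
    if "m \<le> n" for n
  proof -
    let ?F = "\<lambda>t h. G n h * (fraction t - fraction (h ! (n - m)))\<^sup>2"
    have "expectation (\<lambda>\<omega>. g n \<omega> * y n \<omega>) = expectation (\<lambda>\<omega>. ?F (hd (history n \<omega>)) (history n \<omega>))"
      by (simp add: g y that)
    also have "\<dots> \<le> expectation (\<lambda>\<omega>. measure_pmf.expectation (urn_step p (hd (history n \<omega>)))
        (\<lambda>t. ?F t (history n \<omega>)))"
    proof (intro integral_mono)
      show "integrable M (\<lambda>\<omega>. ?F (hd (history n \<omega>)) (history n \<omega>))"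
        by (rule integrable_history[OF p])
      show "integrable M (\<lambda>\<omega>. measure_pmf.expectation (urn_step p (hd (history n \<omega>)))
          (\<lambda>t. ?F t (history n \<omega>)))"
        by (rule integrable_history[OF p])
      show "?F (hd (history n \<omega>)) (history n \<omega>) \<le>
          measure_pmf.expectation (urn_step p (hd (history n \<omega>))) (\<lambda>t. ?F t (history n \<omega>))" for \<omega>
        using fraction_submartingale[OF p] by (simp add: G_def del: hd_history)
    qed
    also have "\<dots> = expectation (\<lambda>\<omega>. ?F (state (Suc n) \<omega>) (history n \<omega>))"
      by (subst expectation_history_Suc[OF p]) simp
    also have "\<dots> = expectation (\<lambda>\<omega>. g n \<omega> * y (Suc n) \<omega>)"
      using that by (simp add: g y_def nth_history)
    finally show ?thesis .
  qed
  have main: "\<epsilon>\<^sup>2 * expectation (g n) \<le> expectation (\<lambda>\<omega>. g n \<omega> * y n \<omega>)"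
    using \<open>m \<le> n\<close>
  proof (induction n rule: dec_induct)
    case base
    show ?case using \<open>0 < \<epsilon>\<close> by (simp add: g_def)
  next
    case (step n)
    note le = \<open>m \<le> n\<close> le_SucI[OF \<open>m \<le> n\<close>]
    have "\<epsilon>\<^sup>2 * expectation (g (Suc n)) =
        \<epsilon>\<^sup>2 * expectation (g n) + \<epsilon>\<^sup>2 * (expectation (g (Suc n)) - expectation (g n))"
      by (simp add: algebra_simps)
    also have "\<dots> \<le> expectation (\<lambda>\<omega>. g n \<omega> * y (Suc n) \<omega>)
        + \<epsilon>\<^sup>2 * (expectation (g (Suc n)) - expectation (g n))"
      using step.IH submart[OF le(1)] by linarith
    also have "\<dots> = expectation (\<lambda>\<omega>. g n \<omega> * y (Suc n) \<omega> + \<epsilon>\<^sup>2 * (g (Suc n) \<omega> - g n \<omega>))"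
      using int_gy le int_g by simp
    also have "\<dots> \<le> expectation (\<lambda>\<omega>. g (Suc n) \<omega> * y (Suc n) \<omega>)"
    proof (intro integral_mono)
      show "integrable M (\<lambda>\<omega>. g n \<omega> * y (Suc n) \<omega> + \<epsilon>\<^sup>2 * (g (Suc n) \<omega> - g n \<omega>))"
        using int_gy le int_g by simp
      show "integrable M (\<lambda>\<omega>. g (Suc n) \<omega> * y (Suc n) \<omega>)"
        using int_gy le by simp
      fix \<omega>
      \<comment> \<open>Paths that first reach the threshold at time \<open>Suc n\<close> have a
        squared deviation of at least \<open>\<epsilon>\<^sup>2\<close> at that time; on all others
        \<open>g\<close> is unchanged.\<close>
      have "\<epsilon> \<le> \<bar>x\<bar> \<Longrightarrow> \<epsilon>\<^sup>2 \<le> x\<^sup>2" for x :: real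
        using \<open>0 < \<epsilon>\<close> by (simp add: abs_le_square_iff[symmetric])
      then show "g n \<omega> * y (Suc n) \<omega> + \<epsilon>\<^sup>2 * (g (Suc n) \<omega> - g n \<omega>) \<le> g (Suc n) \<omega> * y (Suc n) \<omega>"
        using le by (auto simp: g_def y_def atLeastAtMostSuc_conv)
    qed
    finally show ?case .
  qed
  have ev: "g n = indicator {\<omega>. \<exists>k\<in>{m..n}. \<epsilon> \<le> \<bar>fraction (state k \<omega>) - fraction (state m \<omega>)\<bar>}"
    by (auto simp: g_def indicator_def)
  have "\<epsilon>\<^sup>2 * \<P>(\<omega> in M. \<exists>k\<in>{m..n}. \<epsilon> \<le> \<bar>fraction (state k \<omega>) - fraction (state m \<omega>)\<bar>) =
      \<epsilon>\<^sup>2 * expectation (g n)"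
    by (simp add: ev Int_def conj_commute)
  also note main
  also have "expectation (\<lambda>\<omega>. g n \<omega> * y n \<omega>) \<le> expectation (y n)"
    by (intro integral_mono int_gy int_y) (use \<open>m \<le> n\<close> in \<open>auto simp: g_def y_def\<close>)
  also have "\<dots> = expectation (\<lambda>\<omega>. (fraction (state n \<omega>))\<^sup>2) - expectation (\<lambda>\<omega>. (fraction (state m \<omega>))\<^sup>2)"
    unfolding y_def by (rule expectation_fraction_diff_sq[OF p \<open>m \<le> n\<close>])
  finally show ?thesis
    using \<open>0 < \<epsilon>\<close> by (simp add: field_simps)
qed

lemma AE_convergent_fraction:
  assumes p: "0 \<le> p" "p \<le> 1"
  shows "AE \<omega> in M. convergent (\<lambda>n. fraction (state n \<omega>))"
proof (rule AE_convergent_if_maximal_inequality[OF _ maximal_inequality[OF p]])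
  let ?a = "\<lambda>n. expectation (\<lambda>\<omega>. (fraction (state n \<omega>))\<^sup>2)"
  have "incseq ?a"
    unfolding incseq_def
  proof (intro allI impI)
    fix m n :: nat assume "m \<le> n"
    have "0 \<le> expectation (\<lambda>\<omega>. (fraction (state n \<omega>) - fraction (state m \<omega>))\<^sup>2)" by simp
    then show "?a m \<le> ?a n"
      unfolding expectation_fraction_diff_sq[OF p \<open>m \<le> n\<close>] by simp
  qed
  moreover have "?a n \<le> 1" for n
  proof -
    have "(fraction s)\<^sup>2 \<le> 1" for s
      using fraction_bounds[of s] by (simp add: power_le_one)
    then have "?a n \<le> expectation (\<lambda>_. 1)"
      by (intro integral_mono integrable_state[OF p, of "\<lambda>s. (fraction s)\<^sup>2"]) auto
    then show ?thesis by (simp add: prob_space)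
  qed
  ultimately obtain l where "?a \<longlonglongrightarrow> l"
    by (blast intro: incseq_convergent)
  then show "convergent ?a"
    by (rule convergentI)
qed measurable

end

subsection \<open>Surviving lines of descent\<close>

text \<open>\<open>\<gamma>\<close> is the extinction probability of the descent of a ball that
  duplicates with probability \<open>p\<close> and dies with probability \<open>1 - p\<close>: the
  root below \<open>1\<close> of \<open>p * x\<^sup>2 - x + (1 - p) = 0\<close>.\<close>

locale supercritical =
  fixes p \<gamma> :: real
  assumes half_less: "1 / 2 < p" and less_one: "p < 1" and \<gamma>_def: "\<gamma> = (1 - p) / p"
begin

lemma p_bounds: "0 \<le> p" "p \<le> 1"
  using half_less less_one by auto

lemma \<gamma>_pos: "0 < \<gamma>"
  and \<gamma>_less_one: "\<gamma> < 1"
  and p_times_\<gamma>: "p * \<gamma> = 1 - p"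
  using half_less less_one by (auto simp: \<gamma>_def field_simps)

lemma q_mem: "1 - \<gamma> \<in> {0..1}"
  using \<gamma>_pos \<gamma>_less_one by auto

text \<open>Each of \<open>n\<close> balls has an infinite line of descent with probability \<open>1 - \<gamma>\<close>.\<close>

definition survivor_mean :: "nat \<Rightarrow> (nat \<Rightarrow> real) \<Rightarrow> real" where
  "survivor_mean n G = measure_pmf.expectation (binomial_pmf n (1 - \<gamma>)) G"

lemma survivor_mean_sum:
  "survivor_mean n G = (\<Sum>k\<le>n. real (n choose k) * (1 - \<gamma>) ^ k * \<gamma> ^ (n - k) * G k)"
  unfolding survivor_mean_def expectation_binomial_pmf'[OF q_mem] by simp

lemma survivor_mean_add: "survivor_mean n (\<lambda>k. F k + G k) = survivor_mean n F + survivor_mean n G"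
  and survivor_mean_diff: "survivor_mean n (\<lambda>k. F k - G k) = survivor_mean n F - survivor_mean n G"
  and survivor_mean_cmult: "survivor_mean n (\<lambda>k. c * G k) = c * survivor_mean n G"
  and survivor_mean_const: "survivor_mean n (\<lambda>k. c) = c"
  unfolding survivor_mean_def by (simp_all add: integrable_binomial_pmf[OF q_mem])

lemma survivor_mean_mono: "(\<And>k. k \<le> n \<Longrightarrow> F k \<le> G k) \<Longrightarrow> survivor_mean n F \<le> survivor_mean n G"
  unfolding survivor_mean_sum using \<gamma>_pos \<gamma>_less_one by (intro sum_mono mult_left_mono) auto

lemma survivor_mean_swap:
  "survivor_mean m (\<lambda>k. survivor_mean n (F k)) = survivor_mean n (\<lambda>l. survivor_mean m (\<lambda>k. F k l))"
  unfolding survivor_mean_sum sum_distrib_left by (subst sum.swap) (simp add: mult_ac)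

lemma survivor_mean_0: "survivor_mean 0 G = G 0"
  by (simp add: survivor_mean_sum)

lemma survivor_mean_Suc:
  "survivor_mean (Suc n) G = (1 - \<gamma>) * survivor_mean n (\<lambda>k. G (Suc k)) + \<gamma> * survivor_mean n G"
  unfolding survivor_mean_def using \<gamma>_pos \<gamma>_less_one
  by (simp add: binomial_pmf_Suc expectation_bind_bernoulli flip: map_pmf_def)

text \<open>Picking one of the \<open>Suc n\<close> balls and requiring it to survive leaves
  \<open>n\<close> independent balls: the size-biased binomial law is a shifted binomial
  law.\<close>

lemma survivor_mean_size_bias:
  "survivor_mean (Suc n) (\<lambda>k. real k * H k) =
    real (Suc n) * (1 - \<gamma>) * survivor_mean n (\<lambda>k. H (Suc k))"
proof (induction n arbitrary: H)
  case 0
  show ?case by (simp add: survivor_mean_Suc survivor_mean_0)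
next
  case (Suc n)
  have "survivor_mean (Suc (Suc n)) (\<lambda>k. real k * H k) =
      (1 - \<gamma>) * survivor_mean (Suc n) (\<lambda>k. real k * H (Suc k) + H (Suc k))
      + \<gamma> * survivor_mean (Suc n) (\<lambda>k. real k * H k)"
    by (subst survivor_mean_Suc) (simp add: algebra_simps)
  also have "\<dots> = (1 - \<gamma>) * (real (Suc n) * ((1 - \<gamma>) * survivor_mean n (\<lambda>k. H (Suc (Suc k)))
        + \<gamma> * survivor_mean n (\<lambda>k. H (Suc k))) + survivor_mean (Suc n) (\<lambda>k. H (Suc k)))"
    unfolding survivor_mean_add Suc.IH by (simp add: algebra_simps)
  also have "\<dots> = (1 - \<gamma>) * (real (Suc n) * survivor_mean (Suc n) (\<lambda>k. H (Suc k))
        + survivor_mean (Suc n) (\<lambda>k. H (Suc k)))"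
    by (simp only: survivor_mean_Suc[of n "\<lambda>k. H (Suc k)"])
  finally show ?case by (simp add: algebra_simps)
qed

text \<open>The generator of the branching process becomes that of a Yule process of survivors.\<close>

lemma survivor_mean_generator:
  assumes "0 < n"
  shows "real n * (p * survivor_mean (n + 1) G - survivor_mean n G + (1 - p) * survivor_mean (n - 1) G) =
    p * (1 - \<gamma>) * survivor_mean n (\<lambda>k. real k * (G (Suc k) - G k))"
proof -
  obtain m where m: "n = Suc m" using assms gr0_implies_Suc by blast
  \<comment> \<open>All three binomial means are expanded over the \<open>m\<close> remaining balls,
    with two, one or no extra survivors.\<close>
  define x y z where "x = survivor_mean m (\<lambda>k. G (Suc (Suc k)))"
    and "y = survivor_mean m (\<lambda>k. G (Suc k))" and "z = survivor_mean m G"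
  have "p * survivor_mean (n + 1) G - survivor_mean n G + (1 - p) * survivor_mean (n - 1) G =
      p * ((1 - \<gamma>) * ((1 - \<gamma>) * x + \<gamma> * y) + \<gamma> * ((1 - \<gamma>) * y + \<gamma> * z))
      - ((1 - \<gamma>) * y + \<gamma> * z) + (1 - p) * z"
    by (simp add: m survivor_mean_Suc x_def y_def z_def)
  \<comment> \<open>The fixed-point equation of \<open>\<gamma>\<close> cancels \<open>z\<close> and
    makes the coefficients of \<open>x\<close> and \<open>y\<close> opposite.\<close>
  also have "\<dots> = p * (1 - \<gamma>)\<^sup>2 * (x - y)"
    using p_times_\<gamma> by algebra
  finally have 1: "p * survivor_mean (n + 1) G - survivor_mean n G + (1 - p) * survivor_mean (n - 1) G =
      p * (1 - \<gamma>)\<^sup>2 * (x - y)" .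
  have "survivor_mean n (\<lambda>k. real k * (G (Suc k) - G k)) = real n * (1 - \<gamma>) * (x - y)"
    unfolding m survivor_mean_size_bias survivor_mean_diff by (simp add: x_def y_def)
  with 1 show ?thesis by (simp add: power2_eq_square)
qed

definition survivor_mean2 :: "nat \<Rightarrow> nat \<Rightarrow> (nat \<Rightarrow> nat \<Rightarrow> real) \<Rightarrow> real" where
  "survivor_mean2 b w G = survivor_mean b (\<lambda>k. survivor_mean w (G k))"

lemma survivor_mean2_add:
    "survivor_mean2 b w (\<lambda>k l. F k l + G k l) = survivor_mean2 b w F + survivor_mean2 b w G"
  and survivor_mean2_cmult: "survivor_mean2 b w (\<lambda>k l. c * G k l) = c * survivor_mean2 b w G"
  and survivor_mean2_const: "survivor_mean2 b w (\<lambda>k l. c) = c"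
  by (simp_all add: survivor_mean2_def survivor_mean_add survivor_mean_cmult survivor_mean_const)

lemma survivor_mean2_mono:
  "(\<And>k l. k \<le> b \<Longrightarrow> l \<le> w \<Longrightarrow> F k l \<le> G k l) \<Longrightarrow> survivor_mean2 b w F \<le> survivor_mean2 b w G"
  unfolding survivor_mean2_def by (intro survivor_mean_mono) auto

text \<open>Multiplied by \<open>b + w\<close>, an urn step is the sum of the branching generators
  of the two colours. Averaging over survivors turns it into the Polya generator, which annihilates
  \<open>G\<close> by \<open>polya\<close>. At \<open>k = l = 0\<close> that relation is void, so
  \<open>G 0 0\<close> is free.\<close>

lemma survivor_mean2_harmonic:
  assumes bw: "0 < b" "0 < w"
    and polya: "\<And>k l. real (k + l) * G k l = real k * G (Suc k) l + real l * G k (Suc l)"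
  shows "measure_pmf.expectation (urn_step p (b, w)) (\<lambda>(b, w). survivor_mean2 b w G) =
    survivor_mean2 b w G"
proof -
  let ?S = "\<lambda>b w. survivor_mean2 b w G"
  have 1: "real b * (p * ?S (b + 1) w - ?S b w + (1 - p) * ?S (b - 1) w) =
      p * (1 - \<gamma>) * survivor_mean2 b w (\<lambda>k l. real k * (G (Suc k) l - G k l))"
    using survivor_mean_generator[OF bw(1), of "\<lambda>k. survivor_mean w (G k)"]
    by (simp add: survivor_mean2_def survivor_mean_cmult survivor_mean_diff)
  have 2: "real w * (p * ?S b (w + 1) - ?S b w + (1 - p) * ?S b (w - 1)) =
      p * (1 - \<gamma>) * survivor_mean2 b w (\<lambda>k l. real l * (G k (Suc l) - G k l))"
    using survivor_mean_generator[OF bw(2), of "\<lambda>l. survivor_mean b (\<lambda>k. G k l)"]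
    unfolding survivor_mean2_def
    by (simp add: survivor_mean_swap[of b] survivor_mean_cmult survivor_mean_diff)
  have "(real b * (p * ?S (b + 1) w - ?S b w + (1 - p) * ?S (b - 1) w)) +
      (real w * (p * ?S b (w + 1) - ?S b w + (1 - p) * ?S b (w - 1))) =
      p * (1 - \<gamma>) * survivor_mean2 b w (\<lambda>k l. real k * (G (Suc k) l - G k l) + real l * (G k (Suc l) - G k l))"
    unfolding 1 2 survivor_mean2_add by (simp add: algebra_simps)
  also have "(\<lambda>k l. real k * (G (Suc k) l - G k l) + real l * (G k (Suc l) - G k l)) = (\<lambda>k l. 0)"
    using polya by (simp add: fun_eq_iff algebra_simps)
  finally have 3: "real b * (p * ?S (b + 1) w + (1 - p) * ?S (b - 1) w) +
      real w * (p * ?S b (w + 1) + (1 - p) * ?S b (w - 1)) = real (b + w) * ?S b w"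
    by (simp add: survivor_mean2_const algebra_simps)
  have "measure_pmf.expectation (urn_step p (b, w)) (\<lambda>(b, w). ?S b w) =
      (real b * (p * ?S (b + 1) w + (1 - p) * ?S (b - 1) w) +
        real w * (p * ?S b (w + 1) + (1 - p) * ?S b (w - 1))) / real (b + w)"
    using bw p_bounds by (simp add: expectation_urn_step add_divide_distrib)
  then show ?thesis
    unfolding 3 using bw by simp
qed

lemma survivor_mean2_both_extinct:
  "survivor_mean2 b w (\<lambda>k l. if k = 0 \<and> l = 0 then c else 0) = \<gamma> ^ (b + w) * c"
proof -
  have "survivor_mean n (\<lambda>k. if k = 0 then c else 0) = \<gamma> ^ n * c" for n c
  proof -
    have "survivor_mean n (\<lambda>k. if k = 0 then c else 0) =
        (\<Sum>k\<in>{0}. real (n choose k) * (1 - \<gamma>) ^ k * \<gamma> ^ (n - k) * (if k = 0 then c else 0))"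
      unfolding survivor_mean_sum by (intro sum.mono_neutral_right) auto
    then show ?thesis by simp
  qed
  note 1 = this
  have 2: "(\<lambda>k. survivor_mean w (\<lambda>l. if k = 0 \<and> l = 0 then c else 0)) =
      (\<lambda>k. if k = 0 then \<gamma> ^ w * c else 0)"
    by (auto simp: fun_eq_iff 1 survivor_mean_const)
  show ?thesis
    unfolding survivor_mean2_def 2 1 by (simp add: power_add)
qed

lemma survivor_mean_id: "survivor_mean n real = real n * (1 - \<gamma>)"
  using survivor_mean_size_bias[of "n - 1" "\<lambda>_. 1"]
  by (cases n) (simp_all add: survivor_mean_0 survivor_mean_const)

lemma survivor_variance:
  "survivor_mean n (\<lambda>k. (real k - real n * (1 - \<gamma>))\<^sup>2) = real n * (1 - \<gamma>) * \<gamma>"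
proof -
  \<comment> \<open>The second moment comes from size biasing with the identity as
    \<open>H\<close>.\<close>
  have sq: "survivor_mean n (\<lambda>k. real k * real k) = real n * (1 - \<gamma>) * (1 + (real n - 1) * (1 - \<gamma>))"
  proof (cases n)
    case (Suc m)
    then show ?thesis
      by (simp only: survivor_mean_size_bias of_nat_Suc survivor_mean_add survivor_mean_id
          survivor_mean_const) (simp add: algebra_simps)
  qed (simp add: survivor_mean_0)
  have "(\<lambda>k. (real k - real n * (1 - \<gamma>))\<^sup>2) =
      (\<lambda>k. real k * real k - 2 * (real n * (1 - \<gamma>)) * real k + (real n * (1 - \<gamma>))\<^sup>2)"
    by (simp add: fun_eq_iff power2_eq_square algebra_simps)
  then have "survivor_mean n (\<lambda>k. (real k - real n * (1 - \<gamma>))\<^sup>2) =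
      survivor_mean n (\<lambda>k. real k * real k) - 2 * (real n * (1 - \<gamma>)) * survivor_mean n real
      + (real n * (1 - \<gamma>))\<^sup>2"
    by (simp add: survivor_mean_add survivor_mean_diff survivor_mean_cmult survivor_mean_const)
  then show ?thesis
    unfolding sq survivor_mean_id by (simp add: power2_eq_square algebra_simps)
qed

text \<open>A change of measure: \<open>\<gamma> ^ (b + w)\<close> is the probability that no line
  of descent survives, and by \<open>p * \<gamma> = 1 - p\<close> weighting with it exchanges the
  probabilities of adding and removing.\<close>

lemma expectation_\<gamma>_power_urn_step:
  assumes "0 < b" "0 < w"
  shows "measure_pmf.expectation (urn_step p (b, w)) (\<lambda>(b, w). \<gamma> ^ (b + w) * F (b, w)) =
    \<gamma> ^ (b + w) * measure_pmf.expectation (urn_step (1 - p) (b, w)) F"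
proof -
  have e: "p * (\<gamma> ^ (b + 1 + w) * c) = \<gamma> ^ (b + w) * ((1 - p) * c)"
    "(1 - p) * (\<gamma> ^ (b - 1 + w) * c) = \<gamma> ^ (b + w) * (p * c)"
    "p * (\<gamma> ^ (b + (w + 1)) * c) = \<gamma> ^ (b + w) * ((1 - p) * c)"
    "(1 - p) * (\<gamma> ^ (b + (w - 1)) * c) = \<gamma> ^ (b + w) * (p * c)" for c
    using assms by (cases b; cases w; simp add: p_times_\<gamma>[symmetric])+
  have r: "u * (g * A + g * A') + v * (g * C + g * C') = g * (u * (A + A') + v * (C + C'))"
    for u v g A A' C C' :: real
    by algebra
  show ?thesis
    using p_bounds assms by (simp only: expectation_urn_step prod.case e r) (simp add: expectation_urn_step)
qed

end

subsection \<open>Limits of Polya urns\<close>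

lemma beta_density_nonneg:
  assumes "0 < \<alpha>" "0 < \<beta>"
  shows "0 \<le> beta_density \<alpha> \<beta> x"
  using assms by (simp add: beta_density_def Beta_def Gamma_real_pos less_imp_le)

text \<open>The Beta law is conjugate to Bernoulli draws: biasing by \<open>x\<close>, the chance of
  drawing black, raises the first parameter by one.\<close>

lemma beta_density_plus1_left:
  assumes "0 < \<alpha>" "0 < \<beta>"
  shows "(\<alpha> + \<beta>) * (x * beta_density \<alpha> \<beta> x) = \<alpha> * beta_density (\<alpha> + 1) \<beta> x"
proof (cases "0 < x \<and> x < 1")
  case True
  have pos: "0 < Beta \<alpha> \<beta>" "0 < Beta (\<alpha> + 1) \<beta>"
    using assms by (simp_all add: Beta_def Gamma_real_pos)
  have "(\<alpha> + \<beta>) * Beta (\<alpha> + 1) \<beta> = \<alpha> * Beta \<alpha> \<beta>"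
    using assms by (intro Beta_plus1_left) (auto elim: nonpos_Ints_cases)
  then have "\<alpha> / Beta (\<alpha> + 1) \<beta> = (\<alpha> + \<beta>) / Beta \<alpha> \<beta>"
    using pos assms by (simp add: divide_simps)
  note quotient = this
  have "(\<alpha> + \<beta>) * (x * beta_density \<alpha> \<beta> x) =
      (\<alpha> + \<beta>) / Beta \<alpha> \<beta> * (x * x powr (\<alpha> - 1) * (1 - x) powr (\<beta> - 1))"
    using True by (simp add: beta_density_def)
  also have "x * x powr (\<alpha> - 1) = x powr \<alpha>"
    using True by (simp add: powr_diff)
  finally show ?thesis
    unfolding quotient[symmetric] using True by (simp add: beta_density_def)
qed (auto simp: beta_density_def)

lemma beta_density_swap: "beta_density \<alpha> \<beta> x = beta_density \<beta> \<alpha> (1 - x)"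
  by (auto simp: beta_density_def Beta_commute mult.commute)

lemma beta_density_plus1_right:
  assumes "0 < \<alpha>" "0 < \<beta>"
  shows "(\<alpha> + \<beta>) * ((1 - x) * beta_density \<alpha> \<beta> x) = \<beta> * beta_density \<alpha> (\<beta> + 1) x"
  using beta_density_plus1_left[OF assms(2,1), of "1 - x"]
  by (simp add: beta_density_swap[of \<alpha>] add.commute)

lemma AE_beta_distribution: "AE x in beta_distribution \<alpha> \<beta>. x \<in> {0..1}"
  unfolding beta_distribution_def by (subst AE_density) (auto simp: beta_density_def)

text \<open>
  The almost sure limit of the fraction of black balls in a Polya urn with \<open>k\<close> black and \<open>l\<close>
  white balls; an empty urn is sent to \<open>1\<close> with probability \<open>r\<close> and to \<open>0\<close> otherwise.
\<close>

definition polya_limit :: "real \<Rightarrow> nat \<Rightarrow> nat \<Rightarrow> real measure" where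
  "polya_limit r k l =
     (if k = 0 \<and> l = 0 then distr (measure_pmf (bernoulli_pmf r)) borel of_bool
      else if k = 0 then return borel 0
      else if l = 0 then return borel 1
      else beta_distribution (real k) (real l))"

lemma sets_polya_limit [simp, measurable_cong]: "sets (polya_limit r k l) = sets borel"
  by (simp add: polya_limit_def)

lemma prob_space_polya_limit: "prob_space (polya_limit r k l)"
  by (auto simp: polya_limit_def intro!: prob_space_return prob_space_beta_distribution
      measure_pmf.prob_space_distr)

lemma AE_polya_limit: "AE x in polya_limit r k l. x \<in> {0..1}"
proof -
  have "AE x in distr (measure_pmf (bernoulli_pmf r)) borel of_bool. x \<in> {0..1::real}"
    by (subst AE_distr_iff) auto
  moreover have "AE x in return borel c. x \<in> {0..1}" if "c \<in> {0, 1}" for c :: real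
    using that by (subst AE_return) auto
  ultimately show ?thesis
    using AE_beta_distribution unfolding polya_limit_def by (simp only: split: if_split) simp
qed

lemma integrable_polya_limit:
  fixes \<phi> :: "real \<Rightarrow> real"
  assumes "\<phi> \<in> borel_measurable borel" "\<And>x. x \<in> {0..1} \<Longrightarrow> \<bar>\<phi> x\<bar> \<le> C"
  shows "integrable (polya_limit r k l) \<phi>"
proof -
  interpret prob_space "polya_limit r k l" by (rule prob_space_polya_limit)
  show ?thesis
    using assms by (intro integrable_const_bound[where B = C] eventually_mono[OF AE_polya_limit]) auto
qed

definition polya_mean :: "(real \<Rightarrow> real) \<Rightarrow> real \<Rightarrow> nat \<Rightarrow> nat \<Rightarrow> real" where
  "polya_mean \<phi> r k l = integral\<^sup>L (polya_limit r k l) \<phi>"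

lemma polya_mean_simps:
  assumes [measurable]: "\<phi> \<in> borel_measurable borel"
  shows "0 \<le> r \<Longrightarrow> r \<le> 1 \<Longrightarrow> polya_mean \<phi> r 0 0 = r * \<phi> 1 + (1 - r) * \<phi> 0"
    and "0 < l \<Longrightarrow> polya_mean \<phi> r 0 l = \<phi> 0"
    and "0 < k \<Longrightarrow> polya_mean \<phi> r k 0 = \<phi> 1"
    and "0 < k \<Longrightarrow> 0 < l \<Longrightarrow>
      polya_mean \<phi> r k l = (\<integral>x. beta_density (real k) (real l) x * \<phi> x \<partial>lborel)"
  by (simp_all add: polya_mean_def polya_limit_def integral_distr integral_return
      beta_distribution_def integral_density beta_density_nonneg mult.commute)

lemma integrable_beta_density:
  assumes "\<phi> \<in> borel_measurable borel" "\<And>x. x \<in> {0..1} \<Longrightarrow> \<bar>\<phi> x\<bar> \<le> C" "0 < k" "0 < l"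
  shows "integrable lborel (\<lambda>x. beta_density (real k) (real l) x * \<phi> x)"
  using integrable_polya_limit[OF assms(1,2), where r = 0 and k = k and l = l] assms
  by (simp add: polya_limit_def beta_distribution_def integrable_density beta_density_nonneg)

text \<open>Splitting \<open>1 = x + (1 - x)\<close> under the integral conditions on the colour of
  the first draw from the Polya urn.\<close>

lemma polya_mean_harmonic:
  assumes [measurable]: "\<phi> \<in> borel_measurable borel"
    and bound: "\<And>x. x \<in> {0..1} \<Longrightarrow> \<bar>\<phi> x\<bar> \<le> C" and kl: "0 < k" "0 < l"
  shows "real (k + l) * polya_mean \<phi> r k l =
    real k * polya_mean \<phi> r (Suc k) l + real l * polya_mean \<phi> r k (Suc l)"
proof -
  note int = integrable_beta_density[OF assms(1) bound]
  have "real (k + l) * polya_mean \<phi> r k l =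
      (\<integral>x. real (k + l) * (beta_density (real k) (real l) x * \<phi> x) \<partial>lborel)"
    using kl by (simp add: polya_mean_simps)
  also have "\<dots> = (\<integral>x. real k * (beta_density (real (Suc k)) (real l) x * \<phi> x)
      + real l * (beta_density (real k) (real (Suc l)) x * \<phi> x) \<partial>lborel)"
  proof (rule Bochner_Integration.integral_cong[OF refl])
    fix x
    have "real k * (beta_density (real (Suc k)) (real l) x * \<phi> x)
        + real l * (beta_density (real k) (real (Suc l)) x * \<phi> x) =
        (real k * beta_density (real k + 1) (real l) x + real l * beta_density (real k) (real l + 1) x) * \<phi> x"
      by (simp add: algebra_simps)
    also have "\<dots> = real (k + l) * (beta_density (real k) (real l) x * \<phi> x)"
      using kl by (simp flip: beta_density_plus1_left beta_density_plus1_right) (simp add: algebra_simps)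
    finally show "real (k + l) * (beta_density (real k) (real l) x * \<phi> x) =
        real k * (beta_density (real (Suc k)) (real l) x * \<phi> x)
        + real l * (beta_density (real k) (real (Suc l)) x * \<phi> x)" ..
  qed
  also have "\<dots> = real k * polya_mean \<phi> r (Suc k) l + real l * polya_mean \<phi> r k (Suc l)"
    using kl int[of "Suc k" l] int[of k "Suc l"] by (simp add: polya_mean_simps)
  finally show ?thesis .
qed

text \<open>Lowers the degree of moments: with \<open>\<phi>\<close> constant, then the identity, it
  yields the first two moments of the Beta law.\<close>

lemma polya_mean_times_id:
  assumes [measurable]: "\<phi> \<in> borel_measurable borel" and kl: "0 < k" "0 < l"
  shows "real (k + l) * polya_mean (\<lambda>x. x * \<phi> x) r k l = real k * polya_mean \<phi> r (Suc k) l"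
proof -
  have "real (k + l) * (beta_density (real k) (real l) x * (x * \<phi> x)) =
      real k * (beta_density (real k + 1) (real l) x * \<phi> x)" for x
  proof -
    have "real (k + l) * (beta_density (real k) (real l) x * (x * \<phi> x)) =
        (real k + real l) * (x * beta_density (real k) (real l) x) * \<phi> x"
      by (simp add: mult_ac)
    also have "\<dots> = real k * beta_density (real k + 1) (real l) x * \<phi> x"
      using kl by (subst beta_density_plus1_left) auto
    finally show ?thesis by (simp add: mult.assoc)
  qed
  then have "(\<integral>x. real (k + l) * (beta_density (real k) (real l) x * (x * \<phi> x)) \<partial>lborel) =
      (\<integral>x. real k * (beta_density (real k + 1) (real l) x * \<phi> x) \<partial>lborel)"
    by (simp only:)
  then show ?thesis
    using kl by (simp add: polya_mean_simps add.commute)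
qed

lemma polya_mean_mono:
  assumes "\<phi> \<in> borel_measurable borel" "\<And>x. x \<in> {0..1} \<Longrightarrow> \<bar>\<phi> x\<bar> \<le> C"
    and "\<psi> \<in> borel_measurable borel" "\<And>x. x \<in> {0..1} \<Longrightarrow> \<bar>\<psi> x\<bar> \<le> D"
    and "\<And>x. x \<in> {0..1} \<Longrightarrow> \<phi> x \<le> \<psi> x"
  shows "polya_mean \<phi> r k l \<le> polya_mean \<psi> r k l"
  unfolding polya_mean_def
  using assms(5)
  by (intro integral_mono_AE integrable_polya_limit[OF assms(1,2)] integrable_polya_limit[OF assms(3,4)]
      eventually_mono[OF AE_polya_limit])

lemma polya_mean_const: "polya_mean (\<lambda>_. c) r k l = c"
proof -
  interpret prob_space "polya_limit r k l" by (rule prob_space_polya_limit)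
  show ?thesis by (simp add: polya_mean_def prob_space)
qed

text \<open>One formula covers the Beta laws and the point masses at \<open>0\<close> and
  \<open>1\<close>. The numerator isolates the deviation \<open>k - r * (k + l)\<close>; the rest of
  it is at most \<open>k + l\<close>, against a quadratic denominator.\<close>

lemma polya_mean_sq:
  assumes r: "0 \<le> r" "r \<le> 1" and kl: "0 < k + l"
  shows "polya_mean (\<lambda>x. (x - r)\<^sup>2) r k l =
    ((real k - r * real (k + l))\<^sup>2 + real k * (1 - r)\<^sup>2 + real l * r\<^sup>2) / (real (k + l) * (real (k + l) + 1))"
proof (cases "k = 0 \<or> l = 0")
  case True
  \<comment> \<open>With one colour missing the formula collapses: \<open>s\<close> is the number of
    survivors and \<open>c\<close> the squared distance from \<open>r\<close> to the point
    mass.\<close>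
  have eq: "(s\<^sup>2 * c + s * c) / (s * (s + 1)) = c" if "0 < s" for s c :: real
  proof -
    have "s\<^sup>2 * c + s * c = c * (s * (s + 1))"
      by (simp add: power2_eq_square algebra_simps)
    then show ?thesis using that by simp
  qed
  have "(real k - r * real k)\<^sup>2 = (real k)\<^sup>2 * (1 - r)\<^sup>2"
    by (simp add: power2_eq_square algebra_simps)
  then show ?thesis
    using True kl eq[of "real l" "r\<^sup>2"] eq[of "real k" "(1 - r)\<^sup>2"]
    by (auto simp: polya_mean_simps power_mult_distrib mult.commute)
next
  case False
  then have k: "0 < k" and l: "0 < l" by auto
  define x y where "x = real k" and "y = real l"
  have xy: "0 < x" "0 < y" using k l by (auto simp: x_def y_def)
  have m1: "polya_mean (\<lambda>x. x) r k l = real k / real (k + l)" if "0 < k" for k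
    using polya_mean_times_id[of "\<lambda>_. 1" k l r] that l by (simp add: polya_mean_const field_simps)
  have m2: "polya_mean (\<lambda>x. x * x) r k l = x / (x + y) * ((x + 1) / (x + y + 1))"
  proof -
    have "(x + y) * polya_mean (\<lambda>x. x * x) r k l = x * ((x + 1) / (x + y + 1))"
      using polya_mean_times_id[of "\<lambda>x. x" k l r] k l m1[of "Suc k"]
      by (simp add: x_def y_def add_ac)
    then have "polya_mean (\<lambda>x. x * x) r k l = x * ((x + 1) / (x + y + 1)) / (x + y)"
      using xy by (intro nonzero_eq_divide_eq[THEN iffD2]) (auto simp: mult.commute)
    then show ?thesis by simp
  qed
  have i: "integrable (polya_limit r k l) (\<lambda>x. x)" "integrable (polya_limit r k l) (\<lambda>x. x * x)"
    by (rule integrable_polya_limit[where C = 1]; auto simp: abs_mult mult_le_one)+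
  interpret prob_space "polya_limit r k l" by (rule prob_space_polya_limit)
  have "polya_mean (\<lambda>x. (x - r)\<^sup>2) r k l = polya_mean (\<lambda>x. x * x - 2 * r * x + r * r) r k l"
    by (simp add: power2_eq_square algebra_simps)
  also have "\<dots> = polya_mean (\<lambda>x. x * x) r k l - 2 * r * polya_mean (\<lambda>x. x) r k l + r * r"
    unfolding polya_mean_def using i by (simp add: prob_space)
  also have "\<dots> = x / (x + y) * ((x + 1) / (x + y + 1)) - 2 * r * (x / (x + y)) + r * r"
    unfolding m2 m1[OF k] by (simp add: x_def y_def)
  also have "\<dots> = ((x - r * (x + y))\<^sup>2 + x * (1 - r)\<^sup>2 + y * r\<^sup>2) / ((x + y) * (x + y + 1))"
  proof -
    \<comment> \<open>\<open>u\<close> is the first moment and \<open>u * v\<close> the second; the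
      identity is checked after clearing denominators.\<close>
    define u v where "u = x / (x + y)" and "v = (x + 1) / (x + y + 1)"
    have "u * (x + y) = x" "v * (x + y + 1) = x + 1"
      using xy by (simp_all add: u_def v_def)
    have "(u * v - 2 * r * u + r * r) * ((x + y) * (x + y + 1)) =
        (u * (x + y)) * (v * (x + y + 1)) - 2 * r * (u * (x + y)) * (x + y + 1)
        + r * r * (x + y) * (x + y + 1)"
      by (simp add: algebra_simps)
    also have "\<dots> = (x - r * (x + y))\<^sup>2 + x * (1 - r)\<^sup>2 + y * r\<^sup>2"
      unfolding \<open>u * (x + y) = x\<close> \<open>v * (x + y + 1) = x + 1\<close>
      by (simp add: power2_eq_square algebra_simps)
    finally have "(u * v - 2 * r * u + r * r) * ((x + y) * (x + y + 1)) =
        (x - r * (x + y))\<^sup>2 + x * (1 - r)\<^sup>2 + y * r\<^sup>2" .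
    moreover have "(x + y) * (x + y + 1) \<noteq> 0"
      using xy by simp
    ultimately have "u * v - 2 * r * u + r * r =
        ((x - r * (x + y))\<^sup>2 + x * (1 - r)\<^sup>2 + y * r\<^sup>2) / ((x + y) * (x + y + 1))"
      by (intro nonzero_eq_divide_eq[THEN iffD2])
    then show ?thesis
      unfolding u_def v_def .
  qed
  finally show ?thesis by (simp add: x_def y_def)
qed

subsection \<open>Harmonic functions of the urn\<close>

context supercritical
begin

text \<open>The state enters the averaged function only through its value at \<open>(0, 0)\<close>:
  when nobody survives, black is chosen with probability \<open>fraction s\<close>.\<close>

definition harmonic_extension :: "(real \<Rightarrow> real) \<Rightarrow> nat \<times> nat \<Rightarrow> real" where
  "harmonic_extension \<phi> s = survivor_mean2 (fst s) (snd s) (polya_mean \<phi> (fraction s))"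

text \<open>Off \<open>(0, 0)\<close> the value of \<open>polya_mean\<close> does not depend on its
  Bernoulli parameter, which is set to \<open>0\<close> there. The part split off is affine in the
  fraction and weighted by the probability that nobody survives; the two summands are harmonic for
  different reasons.\<close>

lemma harmonic_extension_split:
  assumes [measurable]: "\<phi> \<in> borel_measurable borel"
  shows "harmonic_extension \<phi> (b, w) =
    survivor_mean2 b w (\<lambda>k l. if k = 0 \<and> l = 0 then 0 else polya_mean \<phi> 0 k l)
    + \<gamma> ^ (b + w) * (fraction (b, w) * \<phi> 1 + (1 - fraction (b, w)) * \<phi> 0)"
proof -
  have "polya_mean \<phi> (fraction (b, w)) = (\<lambda>k l. (if k = 0 \<and> l = 0 then 0 else polya_mean \<phi> 0 k l)
      + (if k = 0 \<and> l = 0 then fraction (b, w) * \<phi> 1 + (1 - fraction (b, w)) * \<phi> 0 else 0))"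
    using fraction_bounds by (auto simp: fun_eq_iff polya_mean_simps) (auto simp: polya_mean_def polya_limit_def)
  then show ?thesis
    by (simp add: harmonic_extension_def survivor_mean2_add survivor_mean2_both_extinct)
qed

lemma harmonic_extension_harmonic:
  assumes [measurable]: "\<phi> \<in> borel_measurable borel"
    and bound: "\<And>x. x \<in> {0..1} \<Longrightarrow> \<bar>\<phi> x\<bar> \<le> C"
  shows "measure_pmf.expectation (urn_step p s) (harmonic_extension \<phi>) = harmonic_extension \<phi> s"
proof (cases s)
  case (Pair b w)
  show ?thesis
  proof (cases "b = 0 \<or> w = 0")
    case True
    then show ?thesis by (simp add: Pair expectation_urn_step_absorbed)
  next
    case False
    then have bw: "0 < b" "0 < w" by auto
    note int = integrable_measure_pmf_finite[OF finite_set_pmf_urn_step]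
    define G where "G k l = (if k = 0 \<and> l = 0 then 0 else polya_mean \<phi> 0 k l)" for k l :: nat
    define F where "F s = \<phi> 0 + (\<phi> 1 - \<phi> 0) * fraction s" for s
    have split: "harmonic_extension \<phi> =
        (\<lambda>s. (case s of (b, w) \<Rightarrow> survivor_mean2 b w G) + (case s of (b, w) \<Rightarrow> \<gamma> ^ (b + w) * F (b, w)))"
      by (simp add: fun_eq_iff harmonic_extension_split G_def[abs_def] F_def algebra_simps)
    have "real (k + l) * G k l = real k * G (Suc k) l + real l * G k (Suc l)" for k l
      using polya_mean_harmonic[OF assms, of k l 0]
      by (cases k; cases l) (auto simp: G_def polya_mean_simps)
    then have 1: "measure_pmf.expectation (urn_step p (b, w)) (\<lambda>(b, w). survivor_mean2 b w G) =
        survivor_mean2 b w G"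
      by (rule survivor_mean2_harmonic[OF bw])
    \<comment> \<open>Affine functions of the fraction are preserved by the urn with parameter
      \<open>1 - p\<close> too, and the weight \<open>\<gamma> ^ (b + w)\<close> carries this back
      to \<open>p\<close>.\<close>
    have "measure_pmf.expectation (urn_step (1 - p) (b, w)) F = F (b, w)"
      using p_bounds fraction_martingale[of "1 - p"] by (simp add: F_def[abs_def] int)
    then have 2: "measure_pmf.expectation (urn_step p (b, w)) (\<lambda>(b, w). \<gamma> ^ (b + w) * F (b, w)) =
        \<gamma> ^ (b + w) * F (b, w)"
      by (simp only: expectation_\<gamma>_power_urn_step[OF bw])
    show ?thesis
      unfolding Pair split using 1 2 by (subst Bochner_Integration.integral_add[OF int int]) simp
  qed
qed

section \<open>Concentration of the mixture at the starting fraction\<close>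

definition spread :: "nat \<times> nat \<Rightarrow> real" where
  "spread s = survivor_mean2 (fst s) (snd s) (polya_mean (\<lambda>x. (x - fraction s)\<^sup>2) (fraction s))"

lemma sq_diff_le_one:
  fixes x r :: real
  assumes "x \<in> {0..1}" "0 \<le> r" "r \<le> 1"
  shows "\<bar>(x - r)\<^sup>2\<bar> \<le> 1"
proof -
  have "\<bar>x - r\<bar> \<le> 1" using assms by (simp add: abs_le_iff)
  then show ?thesis by (simp add: abs_square_le_1)
qed

lemma polya_mean_sq_le_one:
  assumes "0 \<le> r" "r \<le> 1"
  shows "polya_mean (\<lambda>x. (x - r)\<^sup>2) r k l \<le> 1"
proof -
  have "polya_mean (\<lambda>x. (x - r)\<^sup>2) r k l \<le> polya_mean (\<lambda>_. 1) r k l"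
    by (rule polya_mean_mono[where C = 1 and D = 1])
      (use sq_diff_le_one[OF _ assms] in auto)
  then show ?thesis by (simp add: polya_mean_const)
qed

lemma spread_le_one: "spread s \<le> 1"
proof -
  have "spread s \<le> survivor_mean2 (fst s) (snd s) (\<lambda>k l. 1)"
    unfolding spread_def using fraction_bounds by (intro survivor_mean2_mono polya_mean_sq_le_one)
  then show ?thesis by (simp add: survivor_mean2_const)
qed

text \<open>An absorbed urn has its limit exactly at its fraction, so it causes no error however few
  balls it holds.\<close>

lemma spread_absorbed:
  assumes "b = 0 \<or> w = 0"
  shows "spread (b, w) = 0"
proof -
  have "spread (b, w) = survivor_mean2 b w (\<lambda>k l. 0)"
  proof (cases "b = 0")
    case True
    have "polya_mean (\<lambda>x. x\<^sup>2) 0 0 = (\<lambda>l. 0)"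
    proof
      show "polya_mean (\<lambda>x. x\<^sup>2) 0 0 l = 0" for l
        by (cases l) (simp_all add: polya_mean_simps)
    qed
    then show ?thesis
      by (simp add: True spread_def survivor_mean2_def survivor_mean_0 fraction_def)
  next
    case False
    then have "fraction (b, w) = 1" and w: "w = 0" using assms by (auto simp: fraction_def)
    moreover have "polya_mean (\<lambda>x. (x - 1)\<^sup>2) 1 k 0 = 0" for k
      by (cases k) (simp_all add: polya_mean_simps)
    ultimately show ?thesis
      by (simp add: w spread_def survivor_mean2_def survivor_mean_0)
  qed
  then show ?thesis by (simp add: survivor_mean2_const)
qed

text \<open>With \<open>N\<close> balls about \<open>N (1 - \<gamma>)\<close> survive. Where fewer than half of that do, the deviation
  of the number of survivors already bounds the left-hand side, which is at most \<open>1\<close>.\<close>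

lemma polya_mean_sq_le:
  assumes r: "0 \<le> r" "r \<le> 1" and m: "0 < m"
  shows "polya_mean (\<lambda>x. (x - r)\<^sup>2) r k l \<le>
    4 / m\<^sup>2 * ((real k - r * real (k + l))\<^sup>2 + (real (k + l) - m)\<^sup>2) + 2 / m"
proof (cases "real (k + l) < m / 2")
  case True
  have "(m / 2)\<^sup>2 \<le> (m - real (k + l))\<^sup>2"
    using True m by (intro power_mono) auto
  also have "\<dots> = (real (k + l) - m)\<^sup>2" by (rule power2_commute)
  also have "\<dots> \<le> (real k - r * real (k + l))\<^sup>2 + (real (k + l) - m)\<^sup>2" by simp
  finally have "4 / m\<^sup>2 * (m / 2)\<^sup>2 \<le> 4 / m\<^sup>2 * ((real k - r * real (k + l))\<^sup>2 + (real (k + l) - m)\<^sup>2)"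
    by (rule mult_left_mono) simp
  moreover have "4 / m\<^sup>2 * (m / 2)\<^sup>2 = 1"
    using m by (simp add: power_divide)
  moreover have "0 < 2 / m" using m by simp
  ultimately show ?thesis
    using polya_mean_sq_le_one[OF r, of k l] by linarith
next
  case False
  define s where "s = real (k + l)"
  define d where "d = real k - r * real (k + l)"
  have s: "m / 2 \<le> s" using False by (simp add: s_def)
  then have s0: "0 < s" using m by linarith
  then have kl: "0 < k + l" unfolding s_def by (simp only: of_nat_0_less_iff)
  have le: "real k * (1 - r)\<^sup>2 + real l * r\<^sup>2 \<le> real k * 1 + real l * 1"
    using r by (intro add_mono mult_left_mono) (auto simp: power_le_one)
  have "polya_mean (\<lambda>x. (x - r)\<^sup>2) r k l = (d\<^sup>2 + real k * (1 - r)\<^sup>2 + real l * r\<^sup>2) / (s * (s + 1))"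
    unfolding polya_mean_sq[OF r kl] by (simp only: s_def d_def)
  also have "\<dots> \<le> (d\<^sup>2 + s) / (s * (s + 1))"
    using le s0 by (intro divide_right_mono) (auto simp: s_def)
  also have "\<dots> = d\<^sup>2 / (s * (s + 1)) + 1 / (s + 1)"
    using s0 by (simp add: add_divide_distrib)
  also have "\<dots> \<le> d\<^sup>2 / (m / 2)\<^sup>2 + 1 / (m / 2)"
  proof (intro add_mono divide_left_mono)
    have "(m / 2)\<^sup>2 \<le> s\<^sup>2" using s m by (intro power_mono) auto
    also have "\<dots> \<le> s * (s + 1)" using s0 by (simp add: power2_eq_square)
    finally show "(m / 2)\<^sup>2 \<le> s * (s + 1)" .
  qed (use s s0 m in auto)
  also have "\<dots> = 4 / m\<^sup>2 * d\<^sup>2 + 2 / m"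
    by (simp add: power_divide)
  also have "\<dots> \<le> 4 / m\<^sup>2 * (d\<^sup>2 + (s - m)\<^sup>2) + 2 / m"
    by (intro add_right_mono mult_left_mono) auto
  finally show ?thesis by (simp only: s_def d_def)
qed

text \<open>Both deviations in \<open>polya_mean_sq_le\<close> are combinations of the centred
  survivor numbers \<open>X\<close> and \<open>Y\<close>. Their variances are at most of the order
  of \<open>m\<close>, the expected number of survivors, so division by \<open>m\<^sup>2\<close>
  leaves order \<open>1 / m\<close>.\<close>

lemma spread_le:
  assumes "0 < b + w"
  shows "spread (b, w) \<le> 18 / (real (b + w) * (1 - \<gamma>))"
proof -
  define r where "r = fraction (b, w)"
  define N q m where "N = real (b + w)" and "q = 1 - \<gamma>" and "m = N * q"
  have r: "0 \<le> r" "r \<le> 1" using fraction_bounds by (auto simp: r_def)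
  have N: "0 < N" and q: "0 < q" "q \<le> 1" and m: "0 < m"
    using assms \<gamma>_pos \<gamma>_less_one by (auto simp: N_def q_def m_def)
  have rN: "real b = r * N"
    using assms by (simp add: r_def fraction_def N_def)
  define X where "X k = real k - real b * q" for k
  define Y where "Y l = real l - real w * q" for l
  have "polya_mean (\<lambda>x. (x - r)\<^sup>2) r k l \<le> 16 / m\<^sup>2 * (X k)\<^sup>2 + 16 / m\<^sup>2 * (Y l)\<^sup>2 + 2 / m" for k l
  proof -
    have sq: "(u + v)\<^sup>2 \<le> 2 * (u\<^sup>2 + v\<^sup>2)" for u v :: real
      using zero_le_power2[of "u - v"] by (simp add: power2_eq_square algebra_simps)
    \<comment> \<open>The constant term \<open>(1 - r) * b * q - r * w * q\<close> vanishes because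
      \<open>r\<close> is the fraction \<open>b / N\<close>.\<close>
    have "real k - r * real (k + l) = (1 - r) * X k + - r * Y l"
      using rN by (simp add: X_def Y_def N_def) algebra
    then have "(real k - r * real (k + l))\<^sup>2 \<le> 2 * (((1 - r) * X k)\<^sup>2 + (- r * Y l)\<^sup>2)"
      using sq by metis
    also have "\<dots> \<le> 2 * ((X k)\<^sup>2 + (Y l)\<^sup>2)"
      unfolding power_mult_distrib using r
      by (intro mult_left_mono add_mono mult_left_le_one_le) (auto simp: power_le_one)
    finally have 1: "(real k - r * real (k + l))\<^sup>2 \<le> 2 * ((X k)\<^sup>2 + (Y l)\<^sup>2)" .
    have "real (k + l) - m = X k + Y l"
      by (simp add: X_def Y_def m_def N_def algebra_simps)
    then have 2: "(real (k + l) - m)\<^sup>2 \<le> 2 * ((X k)\<^sup>2 + (Y l)\<^sup>2)"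
      using sq by metis
    have "4 / m\<^sup>2 * ((real k - r * real (k + l))\<^sup>2 + (real (k + l) - m)\<^sup>2) \<le>
        4 / m\<^sup>2 * (4 * ((X k)\<^sup>2 + (Y l)\<^sup>2))"
      using 1 2 by (intro mult_left_mono) auto
    then show ?thesis
      using polya_mean_sq_le[OF r m, of k l] by (simp add: distrib_left)
  qed
  then have "spread (b, w) \<le> survivor_mean2 b w (\<lambda>k l. 16 / m\<^sup>2 * (X k)\<^sup>2 + 16 / m\<^sup>2 * (Y l)\<^sup>2 + 2 / m)"
    unfolding spread_def r_def[symmetric] fst_conv snd_conv by (intro survivor_mean2_mono)
  also have "\<dots> = 16 / m\<^sup>2 * (real b * q * \<gamma>) + 16 / m\<^sup>2 * (real w * q * \<gamma>) + 2 / m"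
    unfolding survivor_mean2_def survivor_mean_add survivor_mean_cmult survivor_mean_const
      X_def Y_def q_def survivor_variance ..
  also have "\<dots> = 16 / m\<^sup>2 * (m * \<gamma>) + 2 / m"
    unfolding distrib_left[symmetric] by (simp add: m_def N_def algebra_simps)
  \<comment> \<open>The two variances add up to \<open>m * \<gamma>\<close>; since
    \<open>\<gamma> < 1\<close> the constant is at most \<open>16 + 2 = 18\<close>.\<close>
  also have "\<dots> = (16 * \<gamma> + 2) / m"
    using m by (simp add: power2_eq_square add_divide_distrib)
  also have "\<dots> \<le> 18 / m"
    using \<gamma>_less_one m by (intro divide_right_mono) auto
  finally show ?thesis by (simp add: m_def N_def q_def)
qed

text \<open>The Lipschitz bound is linear in the distance while \<open>spread\<close> is quadratic.
  The inequality \<open>\<bar>x - r\<bar> \<le> \<epsilon> + (x - r)\<^sup>2 / \<epsilon>\<close>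
  mediates, with \<open>\<epsilon>\<close> free to balance the two terms.\<close>

lemma harmonic_extension_diff_le:
  assumes [measurable]: "\<phi> \<in> borel_measurable borel"
    and bound: "\<And>x. \<bar>\<phi> x\<bar> \<le> C"
    and lip: "\<And>x y. \<bar>\<phi> x - \<phi> y\<bar> \<le> D * \<bar>x - y\<bar>" and "0 \<le> D" "0 < \<epsilon>"
  shows "\<bar>harmonic_extension \<phi> s - \<phi> (fraction s)\<bar> \<le> D * \<epsilon> + D / \<epsilon> * spread s"
proof -
  \<comment> \<open>The one-sided bound is proved for a general \<open>\<psi>\<close>, so that
    \<open>- \<phi>\<close> supplies the other side.\<close>
  have le: "harmonic_extension \<psi> s \<le> \<psi> (fraction s) + D * \<epsilon> + D / \<epsilon> * spread s"
    if [measurable]: "\<psi> \<in> borel_measurable borel" and bound: "\<And>x. \<bar>\<psi> x\<bar> \<le> C"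
      and lip: "\<And>x y. \<bar>\<psi> x - \<psi> y\<bar> \<le> D * \<bar>x - y\<bar>" for \<psi> :: "real \<Rightarrow> real"
  proof -
    define r where "r = fraction s"
    have r: "0 \<le> r" "r \<le> 1" using fraction_bounds by (auto simp: r_def)
    have pt: "\<psi> x \<le> \<psi> r + D * \<epsilon> + D / \<epsilon> * (x - r)\<^sup>2" for x
    proof -
      have "2 * (\<epsilon> * \<bar>x - r\<bar>) \<le> \<epsilon>\<^sup>2 + \<bar>x - r\<bar>\<^sup>2"
        using sum_squares_bound[of \<epsilon> "\<bar>x - r\<bar>"] by simp
      then have "\<epsilon> * \<bar>x - r\<bar> \<le> \<epsilon> * (\<epsilon> + (x - r)\<^sup>2 / \<epsilon>)"
        using \<open>0 < \<epsilon>\<close> by (simp add: distrib_left power2_eq_square)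
          (smt (verit, best) \<open>0 < \<epsilon>\<close> mult_nonneg_nonneg abs_ge_zero)
      then have "\<bar>x - r\<bar> \<le> \<epsilon> + (x - r)\<^sup>2 / \<epsilon>"
        using \<open>0 < \<epsilon>\<close> by (simp only: mult_le_cancel_left_pos)
      then have "D * \<bar>x - r\<bar> \<le> D * (\<epsilon> + (x - r)\<^sup>2 / \<epsilon>)"
        using \<open>0 \<le> D\<close> by (rule mult_left_mono)
      then show ?thesis
        using lip[of x r] by (simp add: distrib_left)
    qed
    have int: "integrable (polya_limit r k l) (\<lambda>x. (x - r)\<^sup>2)" for k l
      by (rule integrable_polya_limit[where C = 1]) (use sq_diff_le_one[OF _ r] in auto)
    have "polya_mean \<psi> r k l \<le> (\<psi> r + D * \<epsilon>) + D / \<epsilon> * polya_mean (\<lambda>x. (x - r)\<^sup>2) r k l" for k l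
    proof -
      interpret prob_space "polya_limit r k l" by (rule prob_space_polya_limit)
      have "polya_mean \<psi> r k l \<le> integral\<^sup>L (polya_limit r k l) (\<lambda>x. (\<psi> r + D * \<epsilon>) + D / \<epsilon> * (x - r)\<^sup>2)"
        unfolding polya_mean_def
      proof (intro integral_mono)
        show "integrable (polya_limit r k l) \<psi>"
          by (rule integrable_polya_limit[where C = C]) (use bound in auto)
      qed (use int pt in auto)
      also have "\<dots> = (\<psi> r + D * \<epsilon>) + D / \<epsilon> * polya_mean (\<lambda>x. (x - r)\<^sup>2) r k l"
        using int by (simp add: polya_mean_def prob_space)
      finally show ?thesis .
    qed
    then have "harmonic_extension \<psi> s \<le>
        survivor_mean2 (fst s) (snd s) (\<lambda>k l. (\<psi> r + D * \<epsilon>) + D / \<epsilon> * polya_mean (\<lambda>x. (x - r)\<^sup>2) r k l)"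
      unfolding harmonic_extension_def r_def[symmetric] by (intro survivor_mean2_mono)
    then show ?thesis
      unfolding survivor_mean2_add survivor_mean2_cmult survivor_mean2_const spread_def r_def .
  qed
  have "polya_mean (\<lambda>x. - \<phi> x) r = (\<lambda>k l. - 1 * polya_mean \<phi> r k l)" for r
    by (simp add: polya_mean_def fun_eq_iff)
  then have "harmonic_extension (\<lambda>x. - \<phi> x) s = - harmonic_extension \<phi> s"
    unfolding harmonic_extension_def by (simp only: survivor_mean2_cmult)
  moreover have "\<bar>- \<phi> x - - \<phi> y\<bar> \<le> D * \<bar>x - y\<bar>" for x y
    using lip[of x y] by linarith
  ultimately show ?thesis
    using le[of \<phi>] le[of "\<lambda>x. - \<phi> x"] bound lip by fastforce
qed

end

subsection \<open>The limit law\<close>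

text \<open>The two integrals are the real and imaginary parts of the characteristic function, so
  Levy's uniqueness theorem applies.\<close>

lemma real_distribution_eqI:
  assumes "real_distribution M1" "real_distribution M2"
    and cos: "\<And>t. (\<integral>x. cos (t * x) \<partial>M1) = (\<integral>x. cos (t * x) \<partial>M2)"
    and sin: "\<And>t. (\<integral>x. sin (t * x) \<partial>M1) = (\<integral>x. sin (t * x) \<partial>M2)"
  shows "M1 = M2"
proof (rule Levy_uniqueness[OF assms(1,2)])
  have char: "char M t = complex_of_real (\<integral>x. cos (t * x) \<partial>M) + \<i> * complex_of_real (\<integral>x. sin (t * x) \<partial>M)"
    if "real_distribution M" for M t
  proof -
    interpret real_distribution M by fact
    have "integrable M (\<lambda>x. cos (t * x))" "integrable M (\<lambda>x. sin (t * x))"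
      by (auto intro!: integrable_const_bound[where B = 1])
    moreover have "iexp (t * x) = complex_of_real (cos (t * x)) + \<i> * complex_of_real (sin (t * x))" for x
      by (simp add: exp_Euler flip: of_real_mult cos_of_real sin_of_real)
    ultimately show ?thesis
      unfolding char_def by simp
  qed
  show "char M1 = char M2"
    using assms by (simp add: fun_eq_iff char)
qed

lemma set_pmf_survivors:
  assumes "0 < \<gamma>" "\<gamma> < 1" "1 \<le> m"
  shows "set_pmf (survivors_pmf \<gamma> m) \<subseteq> {1..m}"
  by (auto simp: set_pmf_iff pmf_survivors[OF assms] split: if_splits)

lemma finite_set_pmf_survivors:
  assumes "0 < \<gamma>" "\<gamma> < 1" "1 \<le> m"
  shows "finite (set_pmf (survivors_pmf \<gamma> m))"
  using set_pmf_survivors[OF assms] by (rule finite_subset) simp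

lemma measure_mixed_beta:
  assumes "finite (set_pmf G)" "finite (set_pmf H)" "A \<in> sets borel"
  shows "measure (mixed_beta G H) A = measure_pmf.expectation G (\<lambda>k. measure_pmf.expectation H
    (\<lambda>l. measure (beta_distribution (real k) (real l)) A))"
proof -
  have "emeasure (beta_distribution (real k) (real l)) A = measure (beta_distribution (real k) (real l)) A"
    for k l
  proof -
    interpret subprob_space "beta_distribution (real k) (real l)"
      using beta_distribution_subprob by (simp add: space_subprob_algebra)
    show ?thesis by (rule emeasure_eq_measure)
  qed
  then have "emeasure (mixed_beta G H) A =
      (\<integral>\<^sup>+k. \<integral>\<^sup>+l. ennreal (measure (beta_distribution (real k) (real l)) A) \<partial>H \<partial>G)"
    by (simp add: emeasure_mixed_beta[OF assms(3)] nn_integral_pair_pmf')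
  also have "\<dots> = ennreal (measure_pmf.expectation G (\<lambda>k. measure_pmf.expectation H
      (\<lambda>l. measure (beta_distribution (real k) (real l)) A)))"
    using assms by (simp add: nn_integral_eq_integral integrable_measure_pmf_finite)
  finally show ?thesis
    by (simp add: measure_def)
qed

section \<open>The mixture as a single measure\<close>

context supercritical
begin

text \<open>\<open>survivors_pmf\<close> is the binomial law conditioned on at least one survivor;
  no survivor at all has probability \<open>\<gamma> ^ n\<close>.\<close>

lemma survivor_mean_conv_survivors_pmf:
  assumes "1 \<le> n"
  shows "survivor_mean n G =
    \<gamma> ^ n * G 0 + (1 - \<gamma> ^ n) * measure_pmf.expectation (survivors_pmf \<gamma> n) G"
proof -
  note hyps = \<gamma>_pos \<gamma>_less_one assms
  have "\<gamma> ^ n < 1"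
    using hyps by (simp add: power_less_one_iff)
  have "measure_pmf.expectation (survivors_pmf \<gamma> n) G = (\<Sum>k=1..n. G k * pmf (survivors_pmf \<gamma> n) k)"
    using set_pmf_survivors[OF hyps] by (intro integral_measure_pmf_real) auto
  then have "(1 - \<gamma> ^ n) * measure_pmf.expectation (survivors_pmf \<gamma> n) G =
      (\<Sum>k=1..n. real (n choose k) * (1 - \<gamma>) ^ k * \<gamma> ^ (n - k) * G k)"
    using \<open>\<gamma> ^ n < 1\<close> by (simp add: sum_distrib_left pmf_survivors[OF hyps] mult_ac)
  moreover have "{..n} = insert 0 {1..n}" by auto
  ultimately show ?thesis by (simp add: survivor_mean_sum)
qed

text \<open>The mixture before it is sorted by which colours have survivors; in this form
  integrating against it gives \<open>harmonic_extension\<close>.\<close>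

definition limit_law :: "nat \<times> nat \<Rightarrow> real measure" where
  "limit_law s = measure_pmf (binomial_pmf (fst s) (1 - \<gamma>)) \<bind>
     (\<lambda>k. measure_pmf (binomial_pmf (snd s) (1 - \<gamma>)) \<bind> polya_limit (fraction s) k)"

lemma measurable_polya_limit: "polya_limit r k \<in> measure_pmf D \<rightarrow>\<^sub>M prob_algebra borel"
  using prob_space_polya_limit by (auto simp: measurable_def space_prob_algebra)

lemma measurable_bind_polya_limit:
  "(\<lambda>k. measure_pmf D \<bind> polya_limit r k) \<in> measure_pmf E \<rightarrow>\<^sub>M prob_algebra borel"
proof -
  have "measure_pmf D \<in> space (prob_algebra (measure_pmf D))"
    by (simp add: space_prob_algebra measure_pmf.prob_space_axioms)
  note prob_space_bind'[OF this measurable_polya_limit] sets_bind'[OF this measurable_polya_limit]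
  then show ?thesis by (auto simp: measurable_def space_prob_algebra)
qed

lemma real_distribution_limit_law: "real_distribution (limit_law s)"
proof -
  let ?D = "measure_pmf (binomial_pmf (fst s) (1 - \<gamma>))"
  have "?D \<in> space (prob_algebra ?D)"
    by (simp add: space_prob_algebra measure_pmf.prob_space_axioms)
  note prob_space_bind'[OF this measurable_bind_polya_limit] sets_bind'[OF this measurable_bind_polya_limit]
  then show ?thesis
    by (simp add: limit_law_def real_distribution_def real_distribution_axioms_def)
qed

lemma integral_limit_law:
  fixes \<phi> :: "real \<Rightarrow> real"
  assumes "\<phi> \<in> borel_measurable borel" "\<And>x. \<bar>\<phi> x\<bar> \<le> C"
  shows "integral\<^sup>L (limit_law s) \<phi> = harmonic_extension \<phi> s"
proof -
  have bind: "integral\<^sup>L (measure_pmf D \<bind> K) \<phi> = (\<integral>x. integral\<^sup>L (K x) \<phi> \<partial>measure_pmf D)"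
    if K: "K \<in> measure_pmf D \<rightarrow>\<^sub>M prob_algebra borel" for D :: "nat pmf" and K
  proof (rule integral_bind[where B = C and B' = 1])
    show "K \<in> measure_pmf D \<rightarrow>\<^sub>M subprob_algebra borel"
      using K by (rule measurable_prob_algebraD)
    have "prob_space (K x)" for x
      using measurable_space[OF K, of x] by (simp add: space_prob_algebra)
    then show "AE x in measure_pmf D. emeasure (K x) (space (K x)) \<le> ennreal 1"
      by (simp add: prob_space.emeasure_space_1)
  qed (use assms in \<open>auto simp: measure_pmf.finite_measure_axioms\<close>)
  show ?thesis
    unfolding limit_law_def bind[OF measurable_bind_polya_limit] bind[OF measurable_polya_limit]
      harmonic_extension_def survivor_mean2_def survivor_mean_def polya_mean_def ..
qed

text \<open>Conditioning on whether \<open>k\<close> and \<open>l\<close> vanish separates the three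
  parts. The mass at \<open>0\<close> collects \<open>\<gamma> ^ b * (1 - \<gamma> ^ w)\<close>,
  where only white survives, and \<open>\<gamma> ^ (b + w) * (1 - b / (b + w))\<close>, where nobody
  does and white is last; their sum is \<open>extinction_weight \<gamma> b w\<close>.\<close>

lemma measure_limit_law:
  assumes "1 \<le> b" "1 \<le> w" and A: "A \<in> sets borel"
  shows "measure (limit_law (b, w)) A =
      extinction_weight \<gamma> b w * measure (return borel 0) A
    + (1 - \<gamma> ^ b) * (1 - \<gamma> ^ w) * measure (mixed_beta (survivors_pmf \<gamma> b) (survivors_pmf \<gamma> w)) A
    + extinction_weight \<gamma> w b * measure (return borel (1 :: real)) A"
proof -
  interpret Q: real_distribution "limit_law (b, w)" by (rule real_distribution_limit_law)
  note sb = \<gamma>_pos \<gamma>_less_one assms(1) and sw = \<gamma>_pos \<gamma>_less_one assms(2)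
  let ?Gb = "survivors_pmf \<gamma> b" and ?Hw = "survivors_pmf \<gamma> w"
  let ?r = "fraction (b, w)"
  let ?I = "indicator A :: real \<Rightarrow> real"
  have [measurable]: "?I \<in> borel_measurable borel" using A by simp
  \<comment> \<open>Under the conditioned laws both counts are at least one, which leaves only the
    Beta case of \<open>polya_limit\<close>.\<close>
  have beta: "polya_mean ?I ?r k l = measure (beta_distribution (real k) (real l)) A"
    if "k \<in> set_pmf ?Gb" "l \<in> set_pmf ?Hw" for k l
    using that set_pmf_survivors[OF sb] set_pmf_survivors[OF sw] A
    by (auto simp: polya_mean_def polya_limit_def sets_eq_imp_space_eq[OF sets_beta_distribution])
  have zero: "measure_pmf.expectation ?Hw (polya_mean ?I ?r 0) = ?I 0"
  proof -
    have "measure_pmf.expectation ?Hw (polya_mean ?I ?r 0) = measure_pmf.expectation ?Hw (\<lambda>_. ?I 0)"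
      using set_pmf_survivors[OF sw] by (intro integral_cong_AE) (auto simp: AE_measure_pmf_iff polya_mean_simps)
    then show ?thesis by simp
  qed
  have "measure_pmf.expectation ?Gb (\<lambda>k. survivor_mean w (polya_mean ?I ?r k)) =
      measure_pmf.expectation ?Gb (\<lambda>k. \<gamma> ^ w * ?I 1 + (1 - \<gamma> ^ w) *
        measure_pmf.expectation ?Hw (\<lambda>l. measure (beta_distribution (real k) (real l)) A))"
  proof (intro integral_cong_AE AE_pmfI)
    fix k assume k: "k \<in> set_pmf ?Gb"
    then have "polya_mean ?I ?r k 0 = ?I 1"
      using set_pmf_survivors[OF sb] by (auto simp: polya_mean_simps)
    moreover have "measure_pmf.expectation ?Hw (polya_mean ?I ?r k) =
        measure_pmf.expectation ?Hw (\<lambda>l. measure (beta_distribution (real k) (real l)) A)"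
      using k by (intro integral_cong_AE AE_pmfI beta) auto
    ultimately show "survivor_mean w (polya_mean ?I ?r k) = \<gamma> ^ w * ?I 1 + (1 - \<gamma> ^ w) *
        measure_pmf.expectation ?Hw (\<lambda>l. measure (beta_distribution (real k) (real l)) A)"
      by (simp add: survivor_mean_conv_survivors_pmf[OF assms(2)])
  qed auto
  also have "\<dots> = \<gamma> ^ w * ?I 1 + (1 - \<gamma> ^ w) * measure (mixed_beta ?Gb ?Hw) A"
    using A finite_set_pmf_survivors[OF sb] finite_set_pmf_survivors[OF sw]
    by (simp add: measure_mixed_beta integrable_measure_pmf_finite)
  finally have pos: "measure_pmf.expectation ?Gb (\<lambda>k. survivor_mean w (polya_mean ?I ?r k)) =
      \<gamma> ^ w * ?I 1 + (1 - \<gamma> ^ w) * measure (mixed_beta ?Gb ?Hw) A" .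
  have "measure (limit_law (b, w)) A = integral\<^sup>L (limit_law (b, w)) ?I"
    using A by simp
  also have "\<dots> = survivor_mean b (\<lambda>k. survivor_mean w (polya_mean ?I ?r k))"
    by (subst integral_limit_law[where C = 1]) (auto simp: harmonic_extension_def survivor_mean2_def)
  also have "\<dots> = \<gamma> ^ b * (\<gamma> ^ w * (?r * ?I 1 + (1 - ?r) * ?I 0) + (1 - \<gamma> ^ w) * ?I 0)
      + (1 - \<gamma> ^ b) * (\<gamma> ^ w * ?I 1 + (1 - \<gamma> ^ w) * measure (mixed_beta ?Gb ?Hw) A)"
    unfolding survivor_mean_conv_survivors_pmf[OF assms(1)] pos
    unfolding survivor_mean_conv_survivors_pmf[OF assms(2)] zero
    using fraction_bounds by (simp add: polya_mean_simps)
  also have "\<dots> = \<gamma> ^ b * (1 - ?r * \<gamma> ^ w) * ?I 0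
      + (1 - \<gamma> ^ b) * (1 - \<gamma> ^ w) * measure (mixed_beta ?Gb ?Hw) A
      + \<gamma> ^ w * (1 - (1 - ?r) * \<gamma> ^ b) * ?I 1"
    by algebra
  also have "1 - ?r = real w / real (w + b)"
    using assms(1) by (simp add: fraction_def field_simps)
  finally show ?thesis
    using A by (simp add: extinction_weight_def fraction_def measure_return)
qed

text \<open>The choice \<open>\<surd>\<gamma>\<close> minimises the growth factor \<open>p a + (1 - p) / a\<close> of \<open>a ^ N\<close>, and makes it
  \<open>2 \<surd>(p (1 - p)) < 1\<close>.\<close>

definition alive_weight :: "nat \<times> nat \<Rightarrow> real" where
  "alive_weight s = (if fst s = 0 \<or> snd s = 0 then 0 else sqrt \<gamma> ^ (fst s + snd s))"

lemma sqrt_\<gamma>: "0 < sqrt \<gamma>" "sqrt \<gamma> < 1" "2 * p * sqrt \<gamma> < 1"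
proof -
  show "0 < sqrt \<gamma>" "sqrt \<gamma> < 1" using \<gamma>_pos \<gamma>_less_one by auto
  have "(2 * p * sqrt \<gamma>)\<^sup>2 = 4 * p * (p * \<gamma>)"
    using \<gamma>_pos by (simp add: power_mult_distrib power2_eq_square)
  also have "\<dots> = 1 - (2 * p - 1)\<^sup>2"
    unfolding p_times_\<gamma> by (simp add: power2_eq_square algebra_simps)
  also have "\<dots> < 1\<^sup>2" using half_less by simp
  finally show "2 * p * sqrt \<gamma> < 1" by (rule power2_less_imp_less) simp
qed

lemma alive_weight_nonneg: "0 \<le> alive_weight s"
  using \<gamma>_pos by (simp add: alive_weight_def)

text \<open>The factor is below \<open>1\<close> by \<open>sqrt_\<gamma>\<close>. Absorption during
  the step only lowers the weight, so after the step it may be replaced by the bare power of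
  \<open>sqrt \<gamma>\<close>.\<close>

lemma expectation_alive_weight_urn_step:
  "measure_pmf.expectation (urn_step p s) alive_weight \<le> 2 * p * sqrt \<gamma> * alive_weight s"
proof (cases s)
  case (Pair b w)
  show ?thesis
  proof (cases "b = 0 \<or> w = 0")
    case True
    then show ?thesis by (simp add: Pair expectation_urn_step_absorbed alive_weight_def)
  next
    case False
    then have bw: "0 < b" "0 < w" by auto
    let ?a = "sqrt \<gamma>" and ?N = "b + w"
    have le: "alive_weight t \<le> ?a ^ (fst t + snd t)" for t
      using \<gamma>_pos by (simp add: alive_weight_def)
    \<comment> \<open>The two summands are equal, because \<open>?a * ?a = \<gamma>\<close> and
      \<open>p * \<gamma> = 1 - p\<close>.\<close>
    have "p * ?a ^ (?N + 1) + (1 - p) * ?a ^ (?N - 1) = 2 * p * ?a * ?a ^ ?N"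
    proof -
      have "(1 - p) * ?a ^ (?N - 1) = p * (?a * ?a) * ?a ^ (?N - 1)"
        using \<gamma>_pos by (simp add: p_times_\<gamma>)
      also have "\<dots> = p * ?a * ?a ^ ?N"
        using bw by (cases b) auto
      finally show ?thesis by simp
    qed
    note factor = this
    have up: "p * alive_weight t + (1 - p) * alive_weight t' \<le> 2 * p * ?a * ?a ^ ?N"
      if "fst t + snd t = ?N + 1" "fst t' + snd t' = ?N - 1" for t t'
      unfolding factor[symmetric] using le[of t] le[of t'] that p_bounds
      by (intro add_mono mult_left_mono) auto
    have "measure_pmf.expectation (urn_step p s) alive_weight \<le>
        real b / real ?N * (2 * p * ?a * ?a ^ ?N) + real w / real ?N * (2 * p * ?a * ?a ^ ?N)"
      unfolding Pair expectation_urn_step[OF p_bounds bw]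
      using bw by (intro add_mono mult_left_mono up) auto
    also have "\<dots> = (real b / real ?N + real w / real ?N) * (2 * p * ?a * ?a ^ ?N)"
      by (simp only: distrib_right)
    also have "real b / real ?N + real w / real ?N = 1"
      using bw by (simp flip: add_divide_distrib)
    also have "?a ^ ?N = alive_weight s"
      using bw by (simp add: Pair alive_weight_def)
    finally show ?thesis by simp
  qed
qed

text \<open>Absorbed urns and large urns have spread at most \<open>\<epsilon>\<close>; the finitely
  many small live states are covered by a multiple of \<open>alive_weight\<close>.\<close>

lemma spread_le_alive_weight:
  assumes "0 < \<epsilon>"
  obtains c where "0 \<le> c" "\<And>s. spread s \<le> \<epsilon> + c * alive_weight s"
proof -
  \<comment> \<open>From \<open>R\<close> balls on, \<open>spread_le\<close> gives at most
    \<open>\<epsilon>\<close>; with fewer balls in a live urn, the factor \<open>?c\<close> lifts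
    \<open>alive_weight\<close> to at least \<open>1\<close>, the trivial bound on the
    spread.\<close>
  obtain R :: nat where R: "18 / (\<epsilon> * (1 - \<gamma>)) < real R"
    using reals_Archimedean2 by blast
  let ?c = "1 / sqrt \<gamma> ^ R"
  have "spread s \<le> \<epsilon> + ?c * alive_weight s" for s
  proof (cases s)
    case (Pair b w)
    consider "b = 0 \<or> w = 0" | "0 < b" "0 < w" "R \<le> b + w" | "0 < b" "0 < w" "b + w < R"
      by linarith
    then show ?thesis
    proof cases
      case 1
      then show ?thesis
        using \<open>0 < \<epsilon>\<close> by (simp add: Pair spread_absorbed alive_weight_def)
    next
      case 2
      then have "spread s \<le> 18 / (real (b + w) * (1 - \<gamma>))"
        unfolding Pair by (intro spread_le) auto
      also have "\<dots> \<le> \<epsilon>"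
      proof -
        have "18 \<le> \<epsilon> * (1 - \<gamma>) * real R"
          using R \<open>0 < \<epsilon>\<close> \<gamma>_less_one by (simp add: pos_divide_less_eq mult.commute)
        also have "\<dots> \<le> \<epsilon> * (1 - \<gamma>) * real (b + w)"
          using 2 \<open>0 < \<epsilon>\<close> \<gamma>_less_one by (intro mult_left_mono) auto
        finally show ?thesis
          using 2 \<gamma>_less_one by (simp add: pos_divide_le_eq mult_ac)
      qed
      also have "\<dots> \<le> \<epsilon> + ?c * alive_weight s"
        using alive_weight_nonneg \<gamma>_pos by simp
      finally show ?thesis .
    next
      case 3
      have "1 \<le> ?c * alive_weight s"
        using 3 sqrt_\<gamma> by (simp add: Pair alive_weight_def power_decreasing)
      then show ?thesis
        using spread_le_one[of s] \<open>0 < \<epsilon>\<close> by linarith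
    qed
  qed
  moreover have "0 \<le> ?c" using \<gamma>_pos by simp
  ultimately show thesis using that by blast
qed

end

section \<open>Passage to the limit along the urn\<close>

locale supercritical_urn = two_colour_urn M p b w B W + supercritical p \<gamma>
  for M :: "'a measure" and p \<gamma> :: real and b w :: nat and B W :: "nat \<Rightarrow> 'a \<Rightarrow> nat"
begin

lemma expectation_harmonic_extension:
  assumes "\<phi> \<in> borel_measurable borel" "\<And>x. x \<in> {0..1} \<Longrightarrow> \<bar>\<phi> x\<bar> \<le> C"
  shows "expectation (\<lambda>\<omega>. harmonic_extension \<phi> (state n \<omega>)) = harmonic_extension \<phi> (b, w)"
  by (induction n)
    (simp_all only: expectation_state_0[OF p_bounds] expectation_state_Suc[OF p_bounds]
      harmonic_extension_harmonic[OF assms])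

lemma expectation_alive_weight:
  "expectation (\<lambda>\<omega>. alive_weight (state n \<omega>)) \<le> (2 * p * sqrt \<gamma>) ^ n * alive_weight (b, w)"
proof (induction n)
  case 0
  show ?case by (simp add: expectation_state_0[OF p_bounds])
next
  case (Suc n)
  have "expectation (\<lambda>\<omega>. alive_weight (state (Suc n) \<omega>)) \<le>
      expectation (\<lambda>\<omega>. 2 * p * sqrt \<gamma> * alive_weight (state n \<omega>))"
    unfolding expectation_state_Suc[OF p_bounds]
    by (intro integral_mono integrable_state[OF p_bounds] expectation_alive_weight_urn_step)
  also have "\<dots> = 2 * p * sqrt \<gamma> * expectation (\<lambda>\<omega>. alive_weight (state n \<omega>))"
    by simp
  also have "\<dots> \<le> 2 * p * sqrt \<gamma> * ((2 * p * sqrt \<gamma>) ^ n * alive_weight (b, w))"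
    using Suc p_bounds \<gamma>_pos by (intro mult_left_mono) auto
  finally show ?case by simp
qed

lemma eventually_expectation_spread_less:
  assumes "0 < \<epsilon>"
  shows "\<forall>\<^sub>F n in sequentially. expectation (\<lambda>\<omega>. spread (state n \<omega>)) < \<epsilon>"
proof -
  obtain c where c: "0 \<le> c" "\<And>s. spread s \<le> \<epsilon> / 2 + c * alive_weight s"
    using spread_le_alive_weight[of "\<epsilon> / 2"] assms by auto
  let ?q = "2 * p * sqrt \<gamma>"
  have le: "expectation (\<lambda>\<omega>. spread (state n \<omega>)) \<le> \<epsilon> / 2 + c * (?q ^ n * alive_weight (b, w))" for n
  proof -
    have "expectation (\<lambda>\<omega>. spread (state n \<omega>)) \<le>
        expectation (\<lambda>\<omega>. \<epsilon> / 2 + c * alive_weight (state n \<omega>))"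
      using c(2) by (intro integral_mono integrable_state[OF p_bounds])
        (auto intro: integrable_state[OF p_bounds])
    also have "\<dots> = \<epsilon> / 2 + c * expectation (\<lambda>\<omega>. alive_weight (state n \<omega>))"
      by (simp add: integrable_state[OF p_bounds] prob_space)
    also have "\<dots> \<le> \<epsilon> / 2 + c * (?q ^ n * alive_weight (b, w))"
      using c(1) expectation_alive_weight by (intro add_left_mono mult_left_mono)
    finally show ?thesis .
  qed
  have "(\<lambda>n. \<epsilon> / 2 + c * (?q ^ n * alive_weight (b, w))) \<longlonglongrightarrow> \<epsilon> / 2 + c * (0 * alive_weight (b, w))"
    using sqrt_\<gamma> p_bounds by (intro tendsto_intros LIMSEQ_realpow_zero) auto
  then have "\<forall>\<^sub>F n in sequentially. \<epsilon> / 2 + c * (?q ^ n * alive_weight (b, w)) < \<epsilon>"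
    by (rule order_tendstoD(2)) (use assms in simp)
  then show ?thesis
    using le by (auto elim!: eventually_mono intro: le_less_trans)
qed

text \<open>The harmonic extension has constant mean along the urn, and its mean distance from
  \<open>\<phi>\<close> of the fraction is at most an arbitrarily small constant plus a multiple of
  the mean spread, which eventually becomes small.\<close>

lemma expectation_fraction_tendsto:
  assumes [measurable]: "\<phi> \<in> borel_measurable borel"
    and bound: "\<And>x. \<bar>\<phi> x\<bar> \<le> C"
    and lip: "\<And>x y. \<bar>\<phi> x - \<phi> y\<bar> \<le> D * \<bar>x - y\<bar>" and "0 < D"
  shows "(\<lambda>n. expectation (\<lambda>\<omega>. \<phi> (fraction (state n \<omega>)))) \<longlonglongrightarrow> harmonic_extension \<phi> (b, w)"
proof (rule tendstoI)
  fix e :: real assume "0 < e"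
  \<comment> \<open>This makes the Lipschitz error exactly \<open>e / 2\<close> and leaves the other
    half for the spread.\<close>
  define \<epsilon> where "\<epsilon> = e / (2 * D)"
  have \<epsilon>: "0 < \<epsilon>" "D * \<epsilon> = e / 2"
    using \<open>0 < e\<close> \<open>0 < D\<close> by (auto simp: \<epsilon>_def)
  let ?E = "\<lambda>n. expectation (\<lambda>\<omega>. \<phi> (fraction (state n \<omega>)))"
  have le: "\<bar>?E n - harmonic_extension \<phi> (b, w)\<bar> \<le>
      e / 2 + D / \<epsilon> * expectation (\<lambda>\<omega>. spread (state n \<omega>))" for n
  proof -
    note int = integrable_state[OF p_bounds]
    have "\<bar>?E n - harmonic_extension \<phi> (b, w)\<bar> =
        \<bar>expectation (\<lambda>\<omega>. harmonic_extension \<phi> (state n \<omega>) - \<phi> (fraction (state n \<omega>)))\<bar>"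
      using bound by (subst Bochner_Integration.integral_diff)
        (auto simp: int[of "\<lambda>s. \<phi> (fraction s)"] int expectation_harmonic_extension[where C = C])
    also have "\<dots> \<le> expectation (\<lambda>\<omega>. \<bar>harmonic_extension \<phi> (state n \<omega>) - \<phi> (fraction (state n \<omega>))\<bar>)"
      by (rule integral_abs_bound)
    also have "\<dots> \<le> expectation (\<lambda>\<omega>. D * \<epsilon> + D / \<epsilon> * spread (state n \<omega>))"
      using \<open>0 < D\<close> \<epsilon>(1) harmonic_extension_diff_le[OF assms(1) bound lip]
      by (intro integral_mono) (auto simp del: times_divide_eq_left intro!: int integrable_abs Bochner_Integration.integrable_diff)
    also have "\<dots> = e / 2 + D / \<epsilon> * expectation (\<lambda>\<omega>. spread (state n \<omega>))"
      by (simp add: int prob_space \<epsilon>(2) del: times_divide_eq_left)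
    finally show ?thesis .
  qed
  have "\<forall>\<^sub>F n in sequentially. expectation (\<lambda>\<omega>. spread (state n \<omega>)) < e / 2 / (D / \<epsilon>)"
    using \<open>0 < e\<close> \<open>0 < D\<close> \<epsilon>(1) by (intro eventually_expectation_spread_less) auto
  then show "\<forall>\<^sub>F n in sequentially. dist (?E n) (harmonic_extension \<phi> (b, w)) < e"
  proof eventually_elim
    case (elim n)
    then have "D / \<epsilon> * expectation (\<lambda>\<omega>. spread (state n \<omega>)) < e / 2"
      using \<open>0 < D\<close> \<epsilon>(1) by (simp only: pos_less_divide_eq divide_pos_pos mult.commute)
    then show ?case
      using le[of n] unfolding dist_real_def by linarith
  qed
qed

text \<open>For a bounded Lipschitz \<open>\<phi>\<close> the means of \<open>\<phi>\<close> of the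
  fraction converge both to its integral under the law of \<open>L\<close>, by dominated
  convergence, and to its integral under the mixture. Sines and cosines of all frequencies are such
  functions.\<close>

lemma distr_limit_fraction:
  assumes [measurable]: "L \<in> borel_measurable M"
    and lim: "AE \<omega> in M. (\<lambda>n. fraction (state n \<omega>)) \<longlonglongrightarrow> L \<omega>"
  shows "distr M borel L = limit_law (b, w)"
proof (rule real_distribution_eqI)
  show "real_distribution (distr M borel L)" by simp
  show "real_distribution (limit_law (b, w))" by (rule real_distribution_limit_law)
  have eq: "integral\<^sup>L (distr M borel L) \<phi> = integral\<^sup>L (limit_law (b, w)) \<phi>"
    if cont: "continuous_on UNIV \<phi>" and bound: "\<And>x. \<bar>\<phi> x\<bar> \<le> 1"
      and lip: "\<And>x y. \<bar>\<phi> x - \<phi> y\<bar> \<le> D * \<bar>x - y\<bar>" for \<phi> and D :: real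
  proof -
    have [measurable]: "\<phi> \<in> borel_measurable borel"
      using cont by (rule borel_measurable_continuous_onI)
    \<comment> \<open>The frequency, and with it the Lipschitz constant, may be zero, while the rate
      in \<open>expectation_fraction_tendsto\<close> divides by that constant; hence the added
      \<open>1\<close>.\<close>
    have lip': "\<bar>\<phi> x - \<phi> y\<bar> \<le> (\<bar>D\<bar> + 1) * \<bar>x - y\<bar>" for x y
      by (rule order.trans[OF lip mult_right_mono]) auto
    have "(\<lambda>n. expectation (\<lambda>\<omega>. \<phi> (fraction (state n \<omega>)))) \<longlonglongrightarrow> expectation (\<lambda>\<omega>. \<phi> (L \<omega>))"
    proof (rule integral_dominated_convergence[where w = "\<lambda>_. 1"])
      show "AE \<omega> in M. (\<lambda>n. \<phi> (fraction (state n \<omega>))) \<longlonglongrightarrow> \<phi> (L \<omega>)"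
        using lim by eventually_elim (auto intro: continuous_on_tendsto_compose[OF cont])
    qed (use bound in auto)
    moreover have "(\<lambda>n. expectation (\<lambda>\<omega>. \<phi> (fraction (state n \<omega>)))) \<longlonglongrightarrow> harmonic_extension \<phi> (b, w)"
      using bound lip' by (rule expectation_fraction_tendsto[rotated]) auto
    ultimately have "expectation (\<lambda>\<omega>. \<phi> (L \<omega>)) = harmonic_extension \<phi> (b, w)"
      by (rule LIMSEQ_unique)
    then show ?thesis
      using bound by (simp add: integral_distr integral_limit_law[where C = 1])
  qed
  have lip_cos: "\<bar>cos x - cos y\<bar> \<le> \<bar>x - y\<bar>" and lip_sin: "\<bar>sin x - sin y\<bar> \<le> \<bar>x - y\<bar>" for x y :: real
  proof -
    show "\<bar>sin x - sin y\<bar> \<le> \<bar>x - y\<bar>"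
      using field_differentiable_bound[of UNIV sin cos 1 y x] by (auto intro: DERIV_sin)
    show "\<bar>cos x - cos y\<bar> \<le> \<bar>x - y\<bar>"
      using field_differentiable_bound[of UNIV cos "\<lambda>x. - sin x" 1 y x] by (auto intro: DERIV_cos)
  qed
  fix t :: real
  have scale: "\<bar>t * x - t * y\<bar> = \<bar>t\<bar> * \<bar>x - y\<bar>" for x y
    by (simp add: right_diff_distrib[symmetric] abs_mult)
  show "(\<integral>x. cos (t * x) \<partial>distr M borel L) = (\<integral>x. cos (t * x) \<partial>limit_law (b, w))"
    by (rule eq[of _ "\<bar>t\<bar>"]) (auto simp: lip_cos simp flip: scale intro!: continuous_intros)
  show "(\<integral>x. sin (t * x) \<partial>distr M borel L) = (\<integral>x. sin (t * x) \<partial>limit_law (b, w))"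
    by (rule eq[of _ "\<bar>t\<bar>"]) (auto simp: lip_sin simp flip: scale intro!: continuous_intros)
qed

lemma black_fraction_limit:
  obtains L where "L \<in> borel_measurable M"
    "AE \<omega> in M. (\<lambda>n. black_fraction B W n \<omega>) \<longlonglongrightarrow> L \<omega>" "distr M borel L = limit_law (b, w)"
proof -
  \<comment> \<open>\<open>lim\<close> takes some value on divergent paths as well, so
    \<open>L\<close> is defined and measurable everywhere, although convergence to it holds only
    almost surely.\<close>
  define L where "L \<omega> = lim (\<lambda>n. fraction (state n \<omega>))" for \<omega>
  have L: "L \<in> borel_measurable M"
    unfolding L_def by measurable
  have "AE \<omega> in M. (\<lambda>n. fraction (state n \<omega>)) \<longlonglongrightarrow> L \<omega>"
    using AE_convergent_fraction[OF p_bounds]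
    by eventually_elim (simp add: L_def convergent_LIMSEQ_iff)
  with distr_limit_fraction[OF L] L show thesis
    using that by (simp add: black_fraction_eq[abs_def])
qed

end

theorem theorem2p5:
  fixes M :: "'a measure" and p \<gamma> :: real and b w :: nat and B W :: "nat \<Rightarrow> 'a \<Rightarrow> nat"
  assumes "1 / 2 < p" and "p < 1" and "\<gamma> = (1 - p) / p" and "1 \<le> b" and "1 \<le> w"
    and "two_colour_urn M p b w B W"
  shows "\<exists>L. L \<in> borel_measurable M
      \<and> (AE \<omega> in M. (\<lambda>n. black_fraction B W n \<omega>) \<longlonglongrightarrow> L \<omega>)
      \<and> (\<forall>A \<in> sets borel. measure (distr M borel L) A =
            extinction_weight \<gamma> b w * measure (return borel 0) A
          + (1 - \<gamma> ^ b) * (1 - \<gamma> ^ w)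
              * measure (mixed_beta (survivors_pmf \<gamma> b) (survivors_pmf \<gamma> w)) A
          + extinction_weight \<gamma> w b * measure (return borel (1 :: real)) A)"
proof -
  interpret supercritical_urn M p \<gamma> b w B W
    using assms by (simp add: supercritical_urn_def supercritical_def)
  obtain L where L: "L \<in> borel_measurable M" "AE \<omega> in M. (\<lambda>n. black_fraction B W n \<omega>) \<longlonglongrightarrow> L \<omega>"
      and law: "distr M borel L = limit_law (b, w)"
    by (rule black_fraction_limit)
  show ?thesis
    by (rule exI[of _ L]) (use L measure_limit_law[OF assms(4,5)] in \<open>simp add: law\<close>)
qed

end
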